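(* Let $f:\mathbb{R}^n\to\mathbb{R}$ be of class $C^2$, convex, $L$-smooth and bounded below, with $f^\star:=\inf f$ and $\phi(x_1):=f(x_1)-f^\star$. Let $q:\mathbb{R}^n\times\mathbb{R}^m\to\mathbb{R}^m$ be locally Lipschitz and consider $$\dot x_1=x_2,\qquad \dot x_2=u,\qquad \dot z=q(x_1,z),\tag{S}$$ with $x_1,x_2,u\in\mathbb{R}^n$, $z\in\mathbb{R}^m$, and a prescribed reduced running cost $L_r:\mathbb{R}^n\times\mathbb{R}^m\times\mathbb{R}^n\to\mathbb{R}_{\ge0}$. Assume there exist continuously differentiable $V_1^\star:\mathbb{R}^n\times\mathbb{R}^m\to\mathbb{R}$ and $\alpha^\star:\mathbb{R}^n\times\mathbb{R}^m\to\mathbb{R}^n$ and constants $c_\phi,c_z,\lambda,\sigma>0$ such that for all $(x_1,z)$: - $V_1^\star(x_1,z)\ge c_\phi\phi(x_1)+c_z\|z\|^2$; - $\nabla_{x_1}V_1^\star(x_1,z)=\lambda\nabla f(x_1)$; - the stationary Hamilton--Jacobi--Bellman equation for the reduced system $$\dot x_1=a,\qquad \dot z=q(x_1,z)\tag{R}$$ holds, namely $$0=\min_{a\in\mathbb{R}^n}\Bigl\{\nabla_{x_1}V_1^\star(x_1,z)^\top a+\nabla_zV_1^\star(x_1,z)^\top q(x_1,z)+L_r(x_1,z,a)\Bigr\},$$ with minimizer $a=\alpha^\star(x_1,z)$; - $L_r(x_1,z,\alpha^\star(x_1,z))\ge\sigma\|\nabla f(x_1)\|^2$. Assume in addition that boundedness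 of $(\nabla f(x_1),z)$ implies boundedness of $\alpha^\star(x_1,z)$, i.e. for every $R>0$, $\alpha^\star$ is bounded on $\{\|\nabla f(x_1)\|\le R,\ \|z\|\le R\}$. Define $e:=x_2-\alpha^\star(x_1,z)$ and, for $c>0$, $$u^\star:=\dot\alpha^\star-ce-\lambda\nabla f(x_1),$$ where $\dot\alpha^\star=\frac{\partial\alpha^\star}{\partial x_1}x_2+\frac{\partial\alpha^\star}{\partial z}q(x_1,z)$ is the total derivative of $\alpha^\star$ along (S). Then: 1. For every $T>0$ (and given initial state), $\alpha^\star$ minimizes the reduced functional $$\mathcal J_{r,T}(a):=V_1^\star(x_1(T),z(T))+\int_0^TL_r(x_1,z,a)\,dt$$ over all admissible reduced controls $a(\cdot)$ for (R). 2. The function $V^\star:=V_1^\star+\frac12\|e\|^2$ satisfies, along (S) with $u=u^\star$, $$\dot V^\star=-L_r(x_1,z,\alpha^\star)-c\|e\|^2\le-\sigma\|\nabla f(x_1)\|^2-c\|e\|^2 ,$$ and consequently, along every such closed-loop trajectory on $[0,\infty)$, $\nabla f(x_1(t))\to0$ as $t\to\infty$. 3. For fixed $\alpha^\star$ (and given initial state), on every finite horizon $[0,T]$, $u^\star$ is the unique minimizer over all admissible controls $u$ for (S) of $$\mathcal J_{o,T}^{\alpha^\star}(u):=V^\star(x_1(T),z(T),e(T))+\int_0^T\Bigl[L_r(x_1,z,\alpha^\star)+\frac c2\|e\|^2+\frac1{2c}\|u-\dot\alpha^\star+\lambda\nabla f(x_1)\|^2\Bigr]dt .$$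
   Context: $\|\cdot\|$ is the Euclidean norm. $L$-smooth means $\|\nabla f(x)-\nabla f(y)\|\le L\|x-y\|$ for all $x,y\in\mathbb{R}^n$. An admissible control on $[0,T]$ (for (R) or (S)) is an integrable $\mathbb{R}^n$-valued function on $[0,T]$ for which the corresponding system, from the given initial state, has an absolutely continuous solution on $[0,T]$ and the integrand of the cost functional is a measurable function of time; controls equal almost everywhere are identified, and the (nonnegative) cost integrals may be $+\infty$. The feedbacks $\alpha^\star$ (in item 1) and $u^\star$ (in item 3) are understood as the control signals they generate along their own closed-loop trajectories. A dot denotes the time derivative along trajectories. *)

theory Defs
  imports "HOL-Analysis.Analysis"
begin

definition C1 :: "('a::real_normed_vector \<Rightarrow> 'b::real_normed_vector) \<Rightarrow> bool" where
  "C1 F \<longleftrightarrow> (\<exists>F' :: 'a \<Rightarrow> 'a \<Rightarrow>\<^sub>L 'b.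
      (\<forall>x. (F has_derivative blinfun_apply (F' x)) (at x)) \<and> continuous_on UNIV F')"

definition C2 :: "('a::real_normed_vector \<Rightarrow> 'b::real_normed_vector) \<Rightarrow> bool" where
  "C2 F \<longleftrightarrow> (\<exists>F' :: 'a \<Rightarrow> 'a \<Rightarrow>\<^sub>L 'b.
      (\<forall>x. (F has_derivative blinfun_apply (F' x)) (at x)) \<and> C1 F')"

definition grad :: "('a::real_inner \<Rightarrow> real) \<Rightarrow> 'a \<Rightarrow> 'a" where
  "grad f x = (THE g. GDERIV f x :> g)"

(* The library notion has a time argument; here it is constant in time. *)
definition locally_lipschitz :: "('a::metric_space \<Rightarrow> 'b::metric_space) \<Rightarrow> bool" where
  "locally_lipschitz q \<longleftrightarrow> local_lipschitz (UNIV :: real set) UNIV (\<lambda>_. q)"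

(* The usual epsilon-delta notion; D is a finite family of compact intervals with
   pairwise disjoint interiors, and k = {Inf k..Sup k} for each k in D. *)
definition abs_continuous_on :: "real set \<Rightarrow> (real \<Rightarrow> 'a::real_normed_vector) \<Rightarrow> bool" where
  "abs_continuous_on I x \<longleftrightarrow> (\<forall>\<epsilon>>0. \<exists>\<delta>>0. \<forall>D S.
      D division_of S \<and> S \<subseteq> I \<and> (\<Sum>k\<in>D. Sup k - Inf k) < \<delta> \<longrightarrow>
      (\<Sum>k\<in>D. norm (x (Sup k) - x (Inf k))) < \<epsilon>)"

definition ac_solution :: "real \<Rightarrow> (real \<Rightarrow> 'a::real_normed_vector) \<Rightarrow> (real \<Rightarrow> 'a) \<Rightarrow> bool" where
  "ac_solution T x v \<longleftrightarrow> abs_continuous_on {0..T} x \<and>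
     (AE t in lebesgue_on {0..T}. (x has_vector_derivative v t) (at t within {0..T}))"

definition reduced_response ::
  "((real^'n) \<times> (real^'m) \<Rightarrow> real^'m) \<Rightarrow> real \<Rightarrow> real^'n \<Rightarrow> real^'m \<Rightarrow>
   (real \<Rightarrow> real^'n) \<Rightarrow> (real \<Rightarrow> real^'n) \<Rightarrow> (real \<Rightarrow> real^'m) \<Rightarrow> bool" where
  "reduced_response q T x10 z0 a x1 z \<longleftrightarrow>
     x1 0 = x10 \<and> z 0 = z0 \<and>
     ac_solution T x1 a \<and> ac_solution T z (\<lambda>t. q (x1 t, z t))"

definition full_response ::
  "((real^'n) \<times> (real^'m) \<Rightarrow> real^'m) \<Rightarrow> real \<Rightarrow> real^'n \<Rightarrow> real^'n \<Rightarrow> real^'m \<Rightarrow>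
   (real \<Rightarrow> real^'n) \<Rightarrow> (real \<Rightarrow> real^'n) \<Rightarrow> (real \<Rightarrow> real^'n) \<Rightarrow> (real \<Rightarrow> real^'m) \<Rightarrow> bool" where
  "full_response q T x10 x20 z0 u x1 x2 z \<longleftrightarrow>
     x1 0 = x10 \<and> x2 0 = x20 \<and> z 0 = z0 \<and>
     ac_solution T x1 x2 \<and> ac_solution T x2 u \<and> ac_solution T z (\<lambda>t. q (x1 t, z t))"

definition reduced_admissible ::
  "((real^'n) \<times> (real^'m) \<Rightarrow> real^'m) \<Rightarrow> ((real^'n) \<times> (real^'m) \<times> (real^'n) \<Rightarrow> real) \<Rightarrow>
   real \<Rightarrow> real^'n \<Rightarrow> real^'m \<Rightarrow> (real \<Rightarrow> real^'n) \<Rightarrow> bool" where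
  "reduced_admissible q Lr T x10 z0 a \<longleftrightarrow>
     a absolutely_integrable_on {0..T} \<and>
     (\<exists>x1 z. reduced_response q T x10 z0 a x1 z \<and>
        (\<lambda>t. Lr (x1 t, z t, a t)) \<in> borel_measurable (lebesgue_on {0..T}))"

(* For locally Lipschitz q the response to a control is unique on {0..T},
   so the definite description picks out the cost. *)
definition reduced_cost ::
  "((real^'n) \<times> (real^'m) \<Rightarrow> real^'m) \<Rightarrow> ((real^'n) \<times> (real^'m) \<times> (real^'n) \<Rightarrow> real) \<Rightarrow>
   ((real^'n) \<times> (real^'m) \<Rightarrow> real) \<Rightarrow>
   real \<Rightarrow> real^'n \<Rightarrow> real^'m \<Rightarrow> (real \<Rightarrow> real^'n) \<Rightarrow> ereal" where
  "reduced_cost q Lr V1 T x10 z0 a = (THE J. \<exists>x1 z. reduced_response q T x10 z0 a x1 z \<and>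
     J = ereal (V1 (x1 T, z T)) +
         enn2ereal (\<integral>\<^sup>+ t. ennreal (Lr (x1 t, z t, a t)) \<partial>lebesgue_on {0..T}))"

definition err :: "((real^'n) \<times> (real^'m) \<Rightarrow> real^'n) \<Rightarrow> real^'n \<Rightarrow> real^'n \<Rightarrow> real^'m \<Rightarrow> real^'n" where
  "err \<alpha> x1 x2 z = x2 - \<alpha> (x1, z)"

definition alpha_dot ::
  "((real^'n) \<times> (real^'m) \<Rightarrow> real^'m) \<Rightarrow> ((real^'n) \<times> (real^'m) \<Rightarrow> real^'n) \<Rightarrow>
   real^'n \<Rightarrow> real^'n \<Rightarrow> real^'m \<Rightarrow> real^'n" where
  "alpha_dot q \<alpha> x1 x2 z =
     frechet_derivative (\<lambda>x. \<alpha> (x, z)) (at x1) x2 +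
     frechet_derivative (\<lambda>y. \<alpha> (x1, y)) (at z) (q (x1, z))"

definition u_star ::
  "(real^'n \<Rightarrow> real) \<Rightarrow> ((real^'n) \<times> (real^'m) \<Rightarrow> real^'m) \<Rightarrow> ((real^'n) \<times> (real^'m) \<Rightarrow> real^'n) \<Rightarrow>
   real \<Rightarrow> real \<Rightarrow> real^'n \<Rightarrow> real^'n \<Rightarrow> real^'m \<Rightarrow> real^'n" where
  "u_star f q \<alpha> lam c x1 x2 z =
     alpha_dot q \<alpha> x1 x2 z - c *\<^sub>R err \<alpha> x1 x2 z - lam *\<^sub>R grad f x1"

definition V_star :: "((real^'n) \<times> (real^'m) \<Rightarrow> real) \<Rightarrow> real^'n \<Rightarrow> real^'m \<Rightarrow> real^'n \<Rightarrow> real" where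
  "V_star V1 x1 z e = V1 (x1, z) + 1/2 * (norm e)\<^sup>2"

definition outer_running_cost ::
  "(real^'n \<Rightarrow> real) \<Rightarrow> ((real^'n) \<times> (real^'m) \<Rightarrow> real^'m) \<Rightarrow>
   ((real^'n) \<times> (real^'m) \<times> (real^'n) \<Rightarrow> real) \<Rightarrow> ((real^'n) \<times> (real^'m) \<Rightarrow> real^'n) \<Rightarrow>
   real \<Rightarrow> real \<Rightarrow> real^'n \<Rightarrow> real^'n \<Rightarrow> real^'m \<Rightarrow> real^'n \<Rightarrow> real" where
  "outer_running_cost f q Lr \<alpha> lam c x1 x2 z u =
     Lr (x1, z, \<alpha> (x1, z)) + c / 2 * (norm (err \<alpha> x1 x2 z))\<^sup>2 +
     1 / (2 * c) * (norm (u - alpha_dot q \<alpha> x1 x2 z + lam *\<^sub>R grad f x1))\<^sup>2"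

definition outer_admissible ::
  "(real^'n \<Rightarrow> real) \<Rightarrow> ((real^'n) \<times> (real^'m) \<Rightarrow> real^'m) \<Rightarrow>
   ((real^'n) \<times> (real^'m) \<times> (real^'n) \<Rightarrow> real) \<Rightarrow> ((real^'n) \<times> (real^'m) \<Rightarrow> real^'n) \<Rightarrow>
   real \<Rightarrow> real \<Rightarrow> real \<Rightarrow> real^'n \<Rightarrow> real^'n \<Rightarrow> real^'m \<Rightarrow> (real \<Rightarrow> real^'n) \<Rightarrow> bool" where
  "outer_admissible f q Lr \<alpha> lam c T x10 x20 z0 u \<longleftrightarrow>
     u absolutely_integrable_on {0..T} \<and>
     (\<exists>x1 x2 z. full_response q T x10 x20 z0 u x1 x2 z \<and>
        (\<lambda>t. outer_running_cost f q Lr \<alpha> lam c (x1 t) (x2 t) (z t) (u t))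
          \<in> borel_measurable (lebesgue_on {0..T}))"

definition outer_cost ::
  "(real^'n \<Rightarrow> real) \<Rightarrow> ((real^'n) \<times> (real^'m) \<Rightarrow> real^'m) \<Rightarrow>
   ((real^'n) \<times> (real^'m) \<times> (real^'n) \<Rightarrow> real) \<Rightarrow> ((real^'n) \<times> (real^'m) \<Rightarrow> real) \<Rightarrow>
   ((real^'n) \<times> (real^'m) \<Rightarrow> real^'n) \<Rightarrow>
   real \<Rightarrow> real \<Rightarrow> real \<Rightarrow> real^'n \<Rightarrow> real^'n \<Rightarrow> real^'m \<Rightarrow> (real \<Rightarrow> real^'n) \<Rightarrow> ereal" where
  "outer_cost f q Lr V1 \<alpha> lam c T x10 x20 z0 u =
     (THE J. \<exists>x1 x2 z. full_response q T x10 x20 z0 u x1 x2 z \<and>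
        J = ereal (V_star V1 (x1 T) (z T) (err \<alpha> (x1 T) (x2 T) (z T))) +
            enn2ereal (\<integral>\<^sup>+ t. ennreal (outer_running_cost f q Lr \<alpha> lam c (x1 t) (x2 t) (z t) (u t))
                         \<partial>lebesgue_on {0..T}))"

definition reduced_closed_loop ::
  "((real^'n) \<times> (real^'m) \<Rightarrow> real^'m) \<Rightarrow> ((real^'n) \<times> (real^'m) \<Rightarrow> real^'n) \<Rightarrow>
   real \<Rightarrow> real^'n \<Rightarrow> real^'m \<Rightarrow> (real \<Rightarrow> real^'n) \<Rightarrow> (real \<Rightarrow> real^'m) \<Rightarrow> bool" where
  "reduced_closed_loop q \<alpha> T x10 z0 x1 z \<longleftrightarrow>
     reduced_response q T x10 z0 (\<lambda>t. \<alpha> (x1 t, z t)) x1 z"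

definition full_closed_loop ::
  "(real^'n \<Rightarrow> real) \<Rightarrow> ((real^'n) \<times> (real^'m) \<Rightarrow> real^'m) \<Rightarrow> ((real^'n) \<times> (real^'m) \<Rightarrow> real^'n) \<Rightarrow>
   real \<Rightarrow> real \<Rightarrow> real \<Rightarrow> real^'n \<Rightarrow> real^'n \<Rightarrow> real^'m \<Rightarrow>
   (real \<Rightarrow> real^'n) \<Rightarrow> (real \<Rightarrow> real^'n) \<Rightarrow> (real \<Rightarrow> real^'m) \<Rightarrow> bool" where
  "full_closed_loop f q \<alpha> lam c T x10 x20 z0 x1 x2 z \<longleftrightarrow>
     full_response q T x10 x20 z0 (\<lambda>t. u_star f q \<alpha> lam c (x1 t) (x2 t) (z t)) x1 x2 z"

end

theory Submission
  imports Defs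
begin

text \<open>The theorem is a verification argument with a storage function. Along any response of the reduced
system, the chain rule and the Hamilton--Jacobi--Bellman equation give
\<open>d/dt V1(x1, z) = s - Lr(x1, z, a)\<close>, where \<open>s\<close> is the Hamiltonian at the control value \<open>a\<close>. It is
nonnegative and vanishes at \<open>a = \<alpha>(x1, z)\<close>. Integrating, the cost of \<open>a\<close> is \<open>V1\<close> at the initial state
plus the integral of \<open>s\<close>, so \<open>\<alpha>\<close> is optimal.

For the second-order system the same computation is made with \<open>V_star\<close>. Because
\<open>\<nabla>\<^sub>x V1 = lam \<nabla>f\<close>, replacing \<open>\<alpha>\<close> by \<open>x2 = \<alpha> + e\<close> in the reduced dissipation costs the cross term
\<open>lam \<nabla>f \<bullet> e\<close>; the term \<open>- lam \<nabla>f\<close> in \<open>u_star\<close> cancels it. Completing a square then shows that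
\<open>d/dt V_star\<close> is \<open>|u - u_star|\<^sup>2 / (2c)\<close> minus the running cost. So the cost of \<open>u\<close> is
\<open>V_star\<close> at the initial state plus the integral of \<open>|u - u_star|\<^sup>2 / (2c)\<close>, and an optimal \<open>u\<close> agrees
almost everywhere with the feedback evaluated along the response of \<open>u\<close>. That response then is a closed-loop
trajectory, and uniqueness of those identifies \<open>u\<close>.

Admissible responses are only absolutely continuous, and costs may be infinite. The analytic basis
is therefore the fundamental theorem of calculus for absolutely continuous functions
(\<open>abs_continuous_on_has_integral\<close>), proved directly with gauges, and the identity
\<open>ac_solution_cost_balance\<close>, which holds in the extended reals without any integrability hypothesis.

Closed-loop trajectories exist on every horizon because \<open>V1\<close>, respectively \<open>V_star\<close>, does not increase:
its sublevel sets bound \<open>z\<close>, the error \<open>e\<close>, \<open>\<nabla>f\<close> (through the suboptimality gap of \<open>f\<close>) and hence \<open>\<alpha>\<close>, so \<open>x1\<close>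
moves with bounded speed and cannot escape in finite time. A Picard argument for a truncated vector
field turns this a priori bound into existence (\<open>ode_exists_of_a_priori_bound\<close>). As \<open>\<alpha>\<close> is only of
class \<open>C\<^sup>1\<close>, \<open>u_star\<close> is merely continuous; in the coordinates \<open>(x1, e, z)\<close> the derivative of \<open>\<alpha>\<close>
disappears and the closed loop is locally Lipschitz, which gives existence and uniqueness there.

The convergence of \<open>\<nabla>f\<close> to zero is a Barbalat argument: \<open>|\<nabla>f(x1(t))|\<close> is Lipschitz in time, while
\<open>V_star\<close> is bounded below and decreases at rate at least \<open>\<sigma> |\<nabla>f|\<^sup>2\<close>.\<close>

section \<open>Absolutely continuous functions on an interval\<close>

lemma division_real_endpoints:
  fixes D :: "real set set"
  assumes "D division_of S" "k \<in> D"
  shows "Inf k \<le> Sup k" "k = {Inf k..Sup k}" "Inf k \<in> S" "Sup k \<in> S"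
proof -
  obtain a b where ab: "k = cbox a b"
    using division_ofD(4)[OF assms] by blast
  have sub: "k \<subseteq> S" "k \<noteq> {}"
    using division_ofD(2,3)[OF assms] by auto
  then have "a \<le> b" using ab by (auto)
  then show "Inf k \<le> Sup k" "k = {Inf k..Sup k}" "Inf k \<in> S" "Sup k \<in> S"
    using sub unfolding ab by (auto)
qed

lemma abs_continuous_on_subset:
  "abs_continuous_on I x \<Longrightarrow> J \<subseteq> I \<Longrightarrow> abs_continuous_on J x"
  unfolding abs_continuous_on_def by (meson order_trans)

text \<open>Absolute continuity passes to any function whose increments are dominated by those of an
absolutely continuous one. This covers Lipschitz functions (domination by the identity) and compositions with
locally Lipschitz maps.\<close>
lemma abs_continuous_on_mono:
  assumes x: "abs_continuous_on I x" and "K \<ge> 0"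
    and le: "\<And>s t. s \<in> I \<Longrightarrow> t \<in> I \<Longrightarrow> norm (y s - y t) \<le> K * norm (x s - x t)"
  shows "abs_continuous_on I y"
  unfolding abs_continuous_on_def
proof (intro allI impI)
  fix e :: real assume "e > 0"
  with \<open>K \<ge> 0\<close> have eK: "e / (K + 1) > 0" by simp
  obtain d where "d > 0" and d: "\<forall>D S. D division_of S \<and> S \<subseteq> I \<and> (\<Sum>k\<in>D. Sup k - Inf k) < d \<longrightarrow>
       (\<Sum>k\<in>D. norm (x (Sup k) - x (Inf k))) < e / (K + 1)"
    using x eK unfolding abs_continuous_on_def by meson
  show "\<exists>d>0. \<forall>D S. D division_of S \<and> S \<subseteq> I \<and> (\<Sum>k\<in>D. Sup k - Inf k) < d \<longrightarrow>
      (\<Sum>k\<in>D. norm (y (Sup k) - y (Inf k))) < e"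
  proof (intro exI[of _ d] conjI allI impI)
    fix D S assume A: "D division_of S \<and> S \<subseteq> I \<and> (\<Sum>k\<in>D. Sup k - Inf k) < d"
    have "(\<Sum>k\<in>D. norm (y (Sup k) - y (Inf k))) \<le> (\<Sum>k\<in>D. K * norm (x (Sup k) - x (Inf k)))"
      using A division_real_endpoints(3,4)[of D S] by (intro sum_mono le) (metis subsetD)+
    also have "\<dots> \<le> (K + 1) * (\<Sum>k\<in>D. norm (x (Sup k) - x (Inf k)))"
      unfolding sum_distrib_left by (intro sum_mono mult_right_mono) auto
    also have "\<dots> < (K + 1) * (e / (K + 1))"
      using d A \<open>K \<ge> 0\<close> by (intro mult_strict_left_mono) auto
    also have "\<dots> = e" using \<open>K \<ge> 0\<close> by simp
    finally show "(\<Sum>k\<in>D. norm (y (Sup k) - y (Inf k))) < e" .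
  qed fact
qed

lemma abs_continuous_on_triangle:
  assumes x: "abs_continuous_on I x" and y: "abs_continuous_on I y"
    and le: "\<And>s t. s \<in> I \<Longrightarrow> t \<in> I \<Longrightarrow> norm (w s - w t) \<le> norm (x s - x t) + norm (y s - y t)"
  shows "abs_continuous_on I w"
  unfolding abs_continuous_on_def
proof (intro allI impI)
  fix e :: real assume "e > 0"
  then have e2: "e / 2 > 0" by simp
  obtain d1 where "d1 > 0" and d1: "\<forall>D S. D division_of S \<and> S \<subseteq> I \<and> (\<Sum>k\<in>D. Sup k - Inf k) < d1 \<longrightarrow>
       (\<Sum>k\<in>D. norm (x (Sup k) - x (Inf k))) < e / 2"
    using x e2 unfolding abs_continuous_on_def by meson
  obtain d2 where "d2 > 0" and d2: "\<forall>D S. D division_of S \<and> S \<subseteq> I \<and> (\<Sum>k\<in>D. Sup k - Inf k) < d2 \<longrightarrow>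
       (\<Sum>k\<in>D. norm (y (Sup k) - y (Inf k))) < e / 2"
    using y e2 unfolding abs_continuous_on_def by meson
  show "\<exists>d>0. \<forall>D S. D division_of S \<and> S \<subseteq> I \<and> (\<Sum>k\<in>D. Sup k - Inf k) < d \<longrightarrow>
      (\<Sum>k\<in>D. norm (w (Sup k) - w (Inf k))) < e"
  proof (intro exI[of _ "min d1 d2"] conjI allI impI)
    fix D S assume A: "D division_of S \<and> S \<subseteq> I \<and> (\<Sum>k\<in>D. Sup k - Inf k) < min d1 d2"
    have "(\<Sum>k\<in>D. norm (w (Sup k) - w (Inf k)))
        \<le> (\<Sum>k\<in>D. norm (x (Sup k) - x (Inf k)) + norm (y (Sup k) - y (Inf k)))"
      using A division_real_endpoints(3,4)[of D S] by (intro sum_mono le) (metis subsetD)+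
    also have "\<dots> < e"
      using d1[rule_format, of D S] d2[rule_format, of D S] A by (simp add: sum.distrib)
    finally show "(\<Sum>k\<in>D. norm (w (Sup k) - w (Inf k))) < e" .
  qed (use \<open>d1 > 0\<close> \<open>d2 > 0\<close> in auto)
qed

lemma abs_continuous_on_id: "abs_continuous_on I (\<lambda>t. t)"
  unfolding abs_continuous_on_def
proof (intro allI impI)
  fix e :: real assume "e > 0"
  show "\<exists>d>0. \<forall>D S. D division_of S \<and> S \<subseteq> I \<and> (\<Sum>k\<in>D. Sup k - Inf k) < d \<longrightarrow>
      (\<Sum>k\<in>D. norm (Sup k - Inf k)) < e"
  proof (intro exI[of _ e] conjI allI impI)
    fix D S assume A: "D division_of S \<and> S \<subseteq> I \<and> (\<Sum>k\<in>D. Sup k - Inf k) < e"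
    then have "(\<Sum>k\<in>D. norm (Sup k - Inf k)) = (\<Sum>k\<in>D. Sup k - Inf k)"
      using division_real_endpoints(1)[of D S] by (intro sum.cong) auto
    with A show "(\<Sum>k\<in>D. norm (Sup k - Inf k)) < e" by simp
  qed fact
qed

lemma lipschitz_on_imp_abs_continuous_on:
  assumes "K-lipschitz_on I x"
  shows "abs_continuous_on I x"
  by (rule abs_continuous_on_mono[OF abs_continuous_on_id lipschitz_on_nonneg[OF assms]])
    (use lipschitz_on_normD[OF assms] in auto)

lemma abs_continuous_on_imp_continuous_on:
  assumes "abs_continuous_on {a..b} x"
  shows "continuous_on {a..b} x"
  unfolding continuous_on_iff
proof (intro ballI allI impI)
  fix t and e :: real assume t: "t \<in> {a..b}" and "e > 0"
  obtain d where "d > 0" and d: "\<forall>D S. D division_of S \<and> S \<subseteq> {a..b} \<and> (\<Sum>k\<in>D. Sup k - Inf k) < d \<longrightarrow>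
       (\<Sum>k\<in>D. norm (x (Sup k) - x (Inf k))) < e"
    using assms \<open>e > 0\<close> unfolding abs_continuous_on_def by meson
  have pair: "norm (x v - x u) < e" if "a \<le> u" "u \<le> v" "v \<le> b" "v - u < d" for u v
  proof -
    have "{{u..v}} division_of {u..v}"
      using division_of_self[of u v] that by auto
    with d[rule_format, of "{{u..v}}" "{u..v}"] that show ?thesis by auto
  qed
  show "\<exists>d>0. \<forall>s\<in>{a..b}. dist s t < d \<longrightarrow> dist (x s) (x t) < e"
  proof (intro exI[of _ d] conjI ballI impI)
    fix s assume "s \<in> {a..b}" "dist s t < d"
    then show "dist (x s) (x t) < e"
      using pair[of s t] pair[of t s] t by (cases "s \<le> t") (auto simp: dist_norm norm_minus_commute)
  qed fact
qed

text \<open>This controls the part of a Riemann sum whose tags lie in the exceptional null set: its intervals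
fit inside an open set of small measure, so absolute continuity makes the total increment over them
small.\<close>
lemma tagged_partial_division_small_measure:
  fixes x :: "real \<Rightarrow> 'a::real_normed_vector"
  assumes q: "q tagged_partial_division_of {a..b}"
    and U: "\<And>t k. (t, k) \<in> q \<Longrightarrow> k \<subseteq> U" "U \<in> lmeasurable" "measure lebesgue U < d"
    and d: "\<And>D S. D division_of S \<Longrightarrow> S \<subseteq> {a..b} \<Longrightarrow> (\<Sum>k\<in>D. Sup k - Inf k) < d \<Longrightarrow>
       (\<Sum>k\<in>D. norm (x (Sup k) - x (Inf k))) < e"
  shows "(\<Sum>(t,k)\<in>q. norm (x (Sup k) - x (Inf k))) < e"
proof -
  let ?D = "snd ` q"
  have D: "?D division_of \<Union>?D"
    using q by (rule partial_division_of_tagged_division)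
  have sub: "\<Union>?D \<subseteq> {a..b}"
    using q unfolding tagged_partial_division_of_def by fastforce
  have "(\<Sum>k\<in>?D. Sup k - Inf k) = (\<Sum>k\<in>?D. measure lebesgue k)"
  proof (rule sum.cong)
    fix k assume "k \<in> ?D"
    from division_real_endpoints(1,2)[OF D this] show "Sup k - Inf k = measure lebesgue k"
      by (metis measure_completion measure_lborel_Icc sets_lborel atLeastAtMost_borel)
  qed simp
  also have "\<dots> = measure lebesgue (\<Union>?D)"
    using D by (simp add: content_division)
  also have "\<dots> \<le> measure lebesgue U"
  proof (rule measure_mono_fmeasurable[OF _ fmeasurableD[OF lmeasurable_division[OF D]] U(2)])
    show "\<Union>?D \<subseteq> U" using U(1) by force
  qed
  also have "\<dots> < d" by fact
  finally have small: "(\<Sum>k\<in>?D. norm (x (Sup k) - x (Inf k))) < e"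
    using d[OF D sub] by blast
  \<comment> \<open>Degenerate intervals may occur with two different tags, but contribute nothing.\<close>
  have "(\<Sum>(t,k)\<in>q. norm (x (Sup k) - x (Inf k)))
      = (\<Sum>(t,k)\<in>q. if k = {} then 0 else norm (x (Sup k) - x (Inf k)))"
    using q by (intro sum.cong) (auto dest: tagged_partial_division_ofD(2))
  also have "\<dots> = (\<Sum>k\<in>?D. if k = {} then 0 else norm (x (Sup k) - x (Inf k)))"
  proof (rule sum.over_tagged_division_lemma)
    show "q tagged_division_of \<Union>?D"
      using q by (rule tagged_partial_division_of_Union_self)
  qed auto
  also have "\<dots> = (\<Sum>k\<in>?D. norm (x (Sup k) - x (Inf k)))"
    using division_ofD(3)[OF D] by (intro sum.cong) auto
  finally show ?thesis using small by simp
qed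

text \<open>The fundamental theorem of calculus for absolutely continuous functions. The gauge is the usual
derivative gauge at points of differentiability, where the error is proportional to the length of the
interval. At points of the null set \<open>N\<close> it is a fixed open set \<open>U\<close> containing
\<open>N\<close>, so small that absolute continuity bounds the increments. The integrand may be changed to
\<open>0\<close> on \<open>N\<close>. The integral is the gauge integral, so integrability of \<open>v\<close>
is a conclusion.\<close>
theorem abs_continuous_on_has_integral:
  fixes x :: "real \<Rightarrow> 'a::banach"
  assumes "a \<le> b" and ac: "abs_continuous_on {a..b} x" and N: "negligible N"
    and der: "\<And>t. t \<in> {a..b} - N \<Longrightarrow> (x has_vector_derivative v t) (at t within {a..b})"
  shows "(v has_integral x b - x a) {a..b}"
proof (rule has_integral_spike[OF N])
  define g where "g t = (if t \<in> N then 0 else v t)" for t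
  show "\<And>t. t \<in> {a..b} - N \<Longrightarrow> v t = g t"
    by (simp add: g_def)
  show "(g has_integral x b - x a) {a..b}"
    unfolding has_integral_real
  proof (intro allI impI)
    fix e :: real assume "e > 0"
    then have e2: "e / 2 > 0" by simp
    define \<eta> where "\<eta> = e / (2 * (b - a + 1))"
    have "\<eta> > 0" using \<open>e > 0\<close> \<open>a \<le> b\<close> by (simp add: \<eta>_def)
    have \<eta>: "\<eta> * (b - a) \<le> e / 2"
      using \<open>e > 0\<close> \<open>a \<le> b\<close> by (simp add: \<eta>_def field_simps)
    obtain d where "d > 0" and d: "\<forall>D S. D division_of S \<and> S \<subseteq> {a..b} \<and> (\<Sum>k\<in>D. Sup k - Inf k) < d
        \<longrightarrow> (\<Sum>k\<in>D. norm (x (Sup k) - x (Inf k))) < e / 2"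
      using ac e2 unfolding abs_continuous_on_def by meson
    have N0: "N \<in> null_sets lebesgue" using N by (simp add: negligible_iff_null_sets)
    then have Ns: "N \<in> sets lebesgue" by auto
    obtain U where "open U" "N \<subseteq> U" and U: "U - N \<in> lmeasurable" "emeasure lebesgue (U - N) < ennreal d"
      using sets_lebesgue_outer_open[OF Ns \<open>d > 0\<close>] by blast
    have UN: "U = (U - N) \<union> N" using \<open>N \<subseteq> U\<close> by blast
    have Um: "U \<in> lmeasurable"
      using U(1) N0 UN by (metis fmeasurable.Un negligible_iff_measure N)
    have "measure lebesgue U = measure lebesgue (U - N)"
      using Um N0 by (simp add: fmeasurableD measure_Diff_null_set)
    also have "\<dots> < d"
      using U \<open>d > 0\<close> by (simp add: emeasure_eq_measure2 ennreal_less_iff)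
    finally have Ud: "measure lebesgue U < d" .
    have "\<forall>t. \<exists>r>0. t \<in> {a..b} - N \<longrightarrow> (\<forall>s\<in>{a..b}. norm (s - t) < r \<longrightarrow>
        norm (x s - x t - (s - t) *\<^sub>R v t) \<le> \<eta> * norm (s - t))"
      using der \<open>\<eta> > 0\<close> unfolding has_vector_derivative_def has_derivative_within_alt
      by (metis zero_less_one)
    then obtain r where r0: "\<And>t. r t > 0" and
      r: "\<And>t s. t \<in> {a..b} - N \<Longrightarrow> s \<in> {a..b} \<Longrightarrow> norm (s - t) < r t \<Longrightarrow>
          norm (x s - x t - (s - t) *\<^sub>R v t) \<le> \<eta> * norm (s - t)"
      by metis
    define \<gamma> where "\<gamma> t = (if t \<in> N then U else ball t (r t))" for t
    show "\<exists>\<gamma>. gauge \<gamma> \<and> (\<forall>p. p tagged_division_of {a..b} \<and> \<gamma> fine p \<longrightarrow>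
        norm ((\<Sum>(t,k)\<in>p. measure lborel k *\<^sub>R g t) - (x b - x a)) < e)"
    proof (intro exI[of _ \<gamma>] conjI allI impI)
      show "gauge \<gamma>"
        using \<open>open U\<close> \<open>N \<subseteq> U\<close> r0 by (auto simp: gauge_def \<gamma>_def)
      fix p assume "p tagged_division_of {a..b} \<and> \<gamma> fine p"
      then have p: "p tagged_division_of {a..b}" and fine: "\<gamma> fine p" by auto
      note fin = tagged_division_ofD(1)[OF p]
      define h where "h = (\<lambda>(t,k). measure lborel k *\<^sub>R g t - (x (Sup k) - x (Inf k)))"
      define q where "q = {(t,k) \<in> p. t \<in> N}"
      have qp: "q \<subseteq> p" by (auto simp: q_def)
      have "(\<Sum>(t,k)\<in>p. measure lborel k *\<^sub>R g t) - (x b - x a) = (\<Sum>n\<in>p. h n)"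
        unfolding additive_tagged_division_1[OF \<open>a \<le> b\<close> p, of x, symmetric] h_def
        by (simp add: sum_subtractf case_prod_unfold)
      then have "norm ((\<Sum>(t,k)\<in>p. measure lborel k *\<^sub>R g t) - (x b - x a)) \<le> (\<Sum>n\<in>p. norm (h n))"
        by (simp add: norm_sum)
      also have "\<dots> = (\<Sum>n\<in>p - q. norm (h n)) + (\<Sum>n\<in>q. norm (h n))"
        using fin qp by (simp add: sum.subset_diff)
      also have "\<dots> < e / 2 + e / 2"
      proof (rule add_le_less_mono)
        have "(\<Sum>n\<in>q. norm (h n)) = (\<Sum>(t,k)\<in>q. norm (x (Sup k) - x (Inf k)))"
          by (intro sum.cong) (auto simp: q_def h_def g_def norm_minus_commute)
        also have "\<dots> < e / 2"
        proof (rule tagged_partial_division_small_measure[OF _ _ Um Ud])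
          show "q tagged_partial_division_of {a..b}"
            using p qp tagged_partial_division_subset unfolding tagged_division_of_def by blast
          show "k \<subseteq> U" if "(t, k) \<in> q" for t k
            using that fineD[OF fine, of t k] by (auto simp: q_def \<gamma>_def)
        qed (use d in blast)
        finally show "(\<Sum>n\<in>q. norm (h n)) < e / 2" .
        have le: "norm (h (t, k)) \<le> \<eta> * (Sup k - Inf k)" if tk: "(t, k) \<in> p - q" for t k
        proof -
          have tk': "(t, k) \<in> p" "t \<notin> N" using tk by (auto simp: q_def)
          obtain u w where k: "k = cbox u w"
            using tagged_division_ofD(4)[OF p tk'(1)] by blast
          have "t \<in> k" "k \<subseteq> {a..b}" "k \<subseteq> ball t (r t)"
            using tagged_division_ofD(2,3)[OF p tk'(1)] fineD[OF fine tk'(1)] tk'(2)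
            by (auto simp: \<gamma>_def)
          then have t: "u \<le> t" "t \<le> w" "t \<in> {a..b} - N" and "u \<in> {a..b}" "w \<in> {a..b}"
            and "norm (u - t) < r t" "norm (w - t) < r t"
            using tk'(2) unfolding k subset_iff by (auto simp: dist_real_def abs_minus_commute Ball_def dest: spec[of _ u] spec[of _ w])
          note r[OF t(3) \<open>w \<in> {a..b}\<close> \<open>norm (w - t) < r t\<close>] r[OF t(3) \<open>u \<in> {a..b}\<close> \<open>norm (u - t) < r t\<close>]
          moreover have "norm (h (t, k))
              = norm ((x u - x t - (u - t) *\<^sub>R v t) - (x w - x t - (w - t) *\<^sub>R v t))"
            using t by (simp add: h_def k g_def algebra_simps)
          ultimately have "norm (h (t, k)) \<le> \<eta> * norm (u - t) + \<eta> * norm (w - t)"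
            using norm_triangle_ineq4[of "x u - x t - (u - t) *\<^sub>R v t" "x w - x t - (w - t) *\<^sub>R v t"]
            by linarith
          also have "\<dots> = \<eta> * (w - u)" using t by (simp add: algebra_simps)
          finally show ?thesis using t by (simp add: k)
        qed
        have nonneg: "0 \<le> \<eta> * (Sup k - Inf k)" if tk: "(t, k) \<in> p" for t k
        proof -
          obtain u w where "k = cbox u w" "t \<in> k"
            using tagged_division_ofD(2,4)[OF p tk] by blast
          then show ?thesis using \<open>\<eta> > 0\<close> by auto
        qed
        have "(\<Sum>n\<in>p - q. norm (h n)) \<le> (\<Sum>(t,k)\<in>p - q. \<eta> * (Sup k - Inf k))"
          using le by (intro sum_mono) auto
        also have "\<dots> \<le> (\<Sum>(t,k)\<in>p. \<eta> * (Sup k - Inf k))"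
          using fin nonneg by (intro sum_mono2) auto
        also have "\<dots> = \<eta> * (b - a)"
          using additive_tagged_division_1[OF \<open>a \<le> b\<close> p, of "\<lambda>s. s"]
          by (simp add: case_prod_unfold flip: sum_distrib_left)
        also note \<eta>
        finally show "(\<Sum>n\<in>p - q. norm (h n)) \<le> e / 2" .
      qed
      finally show "norm ((\<Sum>(t,k)\<in>p. measure lborel k *\<^sub>R g t) - (x b - x a)) < e" by simp
    qed
  qed
qed

section \<open>Continuously differentiable and locally Lipschitz maps\<close>

lemma C1_has_derivative:
  assumes "C1 F"
  shows "(F has_derivative frechet_derivative F (at x)) (at x)"
  using assms unfolding C1_def by (metis differentiableI frechet_derivative_works)

lemma C1_continuous_on_frechet_derivative:
  assumes "C1 F" "continuous_on S y" "continuous_on S v"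
  shows "continuous_on S (\<lambda>t. frechet_derivative F (at (y t)) (v t))"
proof -
  obtain F' where F': "\<And>x. (F has_derivative blinfun_apply (F' x)) (at x)" "continuous_on UNIV F'"
    using assms(1) unfolding C1_def by blast
  have "frechet_derivative F (at (y t)) (v t) = F' (y t) (v t)" for t
    using frechet_derivative_at[OF F'(1)] by metis
  moreover have "continuous_on S (\<lambda>t. F' (y t) (v t))"
    using assms F'(2) by (intro continuous_intros continuous_on_compose2[OF F'(2)]) auto
  ultimately show ?thesis by simp
qed

text \<open>The form in which the local Lipschitz property is used: in a Euclidean space it is equivalent to
being locally Lipschitz, by compactness of closed balls, and it is stable under composition.\<close>
definition lipschitz_on_balls :: "('a::real_normed_vector \<Rightarrow> 'b::real_normed_vector) \<Rightarrow> bool" where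
  "lipschitz_on_balls F \<longleftrightarrow> (\<forall>R. \<exists>K. K-lipschitz_on (cball 0 R) F)"

lemma lipschitz_on_ballsE:
  assumes "lipschitz_on_balls F"
  obtains K where "K-lipschitz_on (cball 0 R) F" "K > 0"
proof -
  obtain K where K: "K-lipschitz_on (cball 0 R) F"
    using assms unfolding lipschitz_on_balls_def by blast
  then have "(K + 1)-lipschitz_on (cball 0 R) F" by (rule lipschitz_on_le) simp
  with lipschitz_on_nonneg[OF K] show thesis by (intro that) auto
qed

lemma lipschitz_on_balls_C1:
  fixes F :: "'a::euclidean_space \<Rightarrow> 'b::real_normed_vector"
  assumes "C1 F"
  shows "lipschitz_on_balls F"
  unfolding lipschitz_on_balls_def
proof
  fix R :: real
  obtain F' where F': "\<And>x. (F has_derivative blinfun_apply (F' x)) (at x)" "continuous_on UNIV F'"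
    using assms unfolding C1_def by blast
  have "compact (F' ` cball 0 R)"
    using F'(2) continuous_on_subset by (intro compact_continuous_image) auto
  then obtain B where B: "\<And>x. x \<in> cball 0 R \<Longrightarrow> norm (F' x) \<le> B"
    using compact_imp_bounded bounded_iff by (metis imageI)
  have "(max B 0)-lipschitz_on (cball 0 R) F"
  proof (rule lipschitz_onI)
    fix x y :: 'a assume "x \<in> cball 0 R" "y \<in> cball 0 R"
    then have "norm (F x - F y) \<le> max B 0 * norm (x - y)"
      using B by (intro differentiable_bound[of "cball 0 R" F "\<lambda>x. blinfun_apply (F' x)"])
        (auto intro: has_derivative_at_withinI F' simp: norm_blinfun.rep_eq[symmetric] le_max_iff_disj)
    then show "dist (F x) (F y) \<le> max B 0 * dist x y" by (simp add: dist_norm)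
  qed simp
  then show "\<exists>K. K-lipschitz_on (cball 0 R) F" by blast
qed

lemma lipschitz_on_balls_locally_lipschitz:
  fixes F :: "'a::euclidean_space \<Rightarrow> 'b::real_normed_vector"
  assumes "locally_lipschitz F"
  shows "lipschitz_on_balls F"
  unfolding lipschitz_on_balls_def
proof
  fix R :: real
  have ll: "local_lipschitz {0::real} (cball 0 R) (\<lambda>_. F)"
    using assms unfolding locally_lipschitz_def by (rule local_lipschitz_subset) auto
  show "\<exists>K. K-lipschitz_on (cball 0 R) F"
    by (rule local_lipschitz_compact_implies_lipschitz[OF ll]) auto
qed

lemma lipschitz_on_balls_bounded_linear: "bounded_linear F \<Longrightarrow> lipschitz_on_balls F"
  unfolding lipschitz_on_balls_def using bounded_linear.lipschitz_boundE lipschitz_on_subset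
  by (metis subset_UNIV)

lemma lipschitz_on_balls_compose:
  assumes F: "lipschitz_on_balls F" and G: "lipschitz_on_balls G"
  shows "lipschitz_on_balls (\<lambda>x. F (G x))"
  unfolding lipschitz_on_balls_def
proof
  fix R :: real
  obtain K where K: "K-lipschitz_on (cball 0 R) G" "K > 0"
    using lipschitz_on_ballsE[OF G] by blast
  have sub: "G ` cball 0 R \<subseteq> cball 0 (norm (G 0) + K * R)"
  proof safe
    fix x :: 'c assume x: "x \<in> cball 0 R"
    then have "0 \<in> cball (0::'c) R" using norm_ge_zero[of x] by (simp del: norm_ge_zero)
    then have "norm (G x - G 0) \<le> K * norm x"
      using lipschitz_on_normD[OF K(1) x, of 0] by simp
    also have "\<dots> \<le> K * R" using x K by simp
    finally show "G x \<in> cball 0 (norm (G 0) + K * R)"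
      using norm_triangle_sub[of "G x" "G 0"] by simp
  qed
  obtain M where "M-lipschitz_on (cball 0 (norm (G 0) + K * R)) F"
    using lipschitz_on_ballsE[OF F] by blast
  from lipschitz_on_subset[OF this sub]
  have "(M * K)-lipschitz_on (cball 0 R) (\<lambda>x. F (G x))"
    using K(1) by (intro lipschitz_on_compose2)
  then show "\<exists>K. K-lipschitz_on (cball 0 R) (\<lambda>x. F (G x))" by blast
qed

lemma lipschitz_on_balls_Pair:
  assumes "lipschitz_on_balls F" "lipschitz_on_balls G"
  shows "lipschitz_on_balls (\<lambda>x. (F x, G x))"
  using assms unfolding lipschitz_on_balls_def by (blast intro: lipschitz_on_Pair)

lemma lipschitz_on_balls_add:
  assumes "lipschitz_on_balls F" "lipschitz_on_balls G"
  shows "lipschitz_on_balls (\<lambda>x. F x + G x)"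
  using assms unfolding lipschitz_on_balls_def by (blast intro: lipschitz_on_add)

lemma lipschitz_on_balls_continuous_on:
  assumes "lipschitz_on_balls F"
  shows "continuous_on S F"
proof -
  have "isCont F x" for x
  proof -
    obtain K where "K-lipschitz_on (cball 0 (norm x + 1)) F"
      using lipschitz_on_ballsE[OF assms] by blast
    then have "continuous_on (ball 0 (norm x + 1)) F"
      using lipschitz_on_continuous_on lipschitz_on_subset ball_subset_cball by blast
    then show ?thesis by (simp add: continuous_on_eq_continuous_at)
  qed
  then show ?thesis by (simp add: continuous_at_imp_continuous_on)
qed

text \<open>Riesz representation: \<open>grad\<close> is a definite description, and differentiability is what
makes it denote the derivative.\<close>
lemma has_gradient:
  fixes f :: "'a::euclidean_space \<Rightarrow> real"
  assumes "(f has_derivative f') (at x)"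
  shows "f' h = grad f x \<bullet> h"
proof -
  define g where "g = (\<Sum>b\<in>Basis. f' b *\<^sub>R b)"
  have lin: "linear f'" using assms has_derivative_linear by blast
  have f': "f' = (\<lambda>h. h \<bullet> g)"
  proof
    fix h
    have "f' h = f' (\<Sum>b\<in>Basis. (h \<bullet> b) *\<^sub>R b)" by (simp add: euclidean_representation)
    also have "\<dots> = (\<Sum>b\<in>Basis. (h \<bullet> b) *\<^sub>R f' b)"
      using lin by (simp add: linear_sum linear_scale)
    also have "\<dots> = h \<bullet> g"
      by (simp add: g_def inner_sum_right mult.commute)
    finally show "f' h = h \<bullet> g" .
  qed
  have "grad f x = g" unfolding grad_def
  proof (rule the_equality)
    show "GDERIV f x :> g" using assms f' by (simp add: gderiv_def)
    fix y assume "GDERIV f x :> y"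
    then have "(\<lambda>h. h \<bullet> y) = (\<lambda>h. h \<bullet> g)"
      using has_derivative_unique[OF assms] f' unfolding gderiv_def by metis
    then show "y = g" by (metis inner_commute vector_eq_ldot)
  qed
  then show ?thesis using f' by (simp add: inner_commute)
qed


section \<open>Absolutely continuous solutions\<close>

lemma ac_solution_iff:
  "ac_solution T x v \<longleftrightarrow> abs_continuous_on {0..T} x \<and>
     (\<exists>N. negligible N \<and> (\<forall>t\<in>{0..T} - N. (x has_vector_derivative v t) (at t within {0..T})))"
  (is "_ \<longleftrightarrow> _ \<and> ?R")
proof -
  have "(AE t in lebesgue_on {0..T}. (x has_vector_derivative v t) (at t within {0..T}))
      \<longleftrightarrow> (AE t in lebesgue. t \<in> {0..T} \<longrightarrow> (x has_vector_derivative v t) (at t within {0..T}))"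
    by (subst AE_restrict_space_iff) auto
  also have "\<dots> \<longleftrightarrow> ?R"
    unfolding eventually_ae_filter_negligible by (intro ex_cong1) auto
  finally show ?thesis unfolding ac_solution_def by blast
qed

lemma ac_solution_continuous_on: "ac_solution T x v \<Longrightarrow> continuous_on {0..T} x"
  unfolding ac_solution_def by (blast intro: abs_continuous_on_imp_continuous_on)

lemma ac_solution_cong:
  assumes "ac_solution T x v" "\<And>t. t \<in> {0..T} \<Longrightarrow> v t = w t"
  shows "ac_solution T x w"
  using assms unfolding ac_solution_iff by (metis DiffD1)

lemma ac_solution_cong_AE:
  assumes "ac_solution T x v" "AE t in lebesgue_on {0..T}. v t = w t"
  shows "ac_solution T x w"
proof -
  from assms have "AE t in lebesgue_on {0..T}. (x has_vector_derivative v t) (at t within {0..T})"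
    unfolding ac_solution_def by blast
  with assms(2) have "AE t in lebesgue_on {0..T}. (x has_vector_derivative w t) (at t within {0..T})"
    by eventually_elim simp
  with assms(1) show ?thesis unfolding ac_solution_def by blast
qed

lemma ac_solution_has_integral:
  fixes x :: "real \<Rightarrow> 'a::banach"
  assumes x: "ac_solution T x v" and t: "t \<in> {0..T}"
  shows "(v has_integral x t - x 0) {0..t}"
proof -
  obtain N where "negligible N" and
    N: "\<And>s. s \<in> {0..T} - N \<Longrightarrow> (x has_vector_derivative v s) (at s within {0..T})"
    using x unfolding ac_solution_iff by blast
  show ?thesis
  proof (rule abs_continuous_on_has_integral[OF _ _ \<open>negligible N\<close>])
    show "abs_continuous_on {0..t} x"
      using x t unfolding ac_solution_def by (auto intro: abs_continuous_on_subset)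
    show "(x has_vector_derivative v s) (at s within {0..t})" if "s \<in> {0..t} - N" for s
      using that t N[of s] by (auto intro: has_vector_derivative_within_subset)
  qed (use t in auto)
qed

lemma ac_solution_unique:
  fixes x :: "real \<Rightarrow> 'a::banach"
  assumes "ac_solution T x v" "ac_solution T y v" "x 0 = y 0" "t \<in> {0..T}"
  shows "x t = y t"
  using has_integral_unique[OF ac_solution_has_integral[OF assms(1,4)] ac_solution_has_integral[OF assms(2,4)]]
    assms(3) by simp

text \<open>A solution with a continuous rate is the primitive of that rate, so its derivative exists at every
point, not just almost everywhere.\<close>
lemma ac_solution_has_vector_derivative:
  fixes x :: "real \<Rightarrow> 'a::banach"
  assumes x: "ac_solution T x v" and v: "continuous_on {0..T} v" and t: "t \<in> {0..T}"
  shows "(x has_vector_derivative v t) (at t within {0..T})"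
proof -
  have "((\<lambda>s. x 0 + integral {0..s} v) has_vector_derivative 0 + v t) (at t within {0..T})"
    using integral_has_vector_derivative[OF v t] by (intro has_vector_derivative_add) auto
  then show ?thesis
    unfolding add_0
    by (rule has_vector_derivative_transform[OF t, rotated])
      (use integral_unique[OF ac_solution_has_integral[OF x]] in auto)
qed

lemma norm_increment_le_of_norm_derivative_le:
  fixes x :: "real \<Rightarrow> 'a::real_normed_vector"
  assumes "convex I" and x: "\<And>t. t \<in> I \<Longrightarrow> (x has_vector_derivative v t) (at t within I)"
    and v: "\<And>t. t \<in> I \<Longrightarrow> norm (v t) \<le> B" and st: "s \<in> I" "t \<in> I"
  shows "norm (x s - x t) \<le> B * norm (s - t)"
proof (rule differentiable_bound[OF \<open>convex I\<close> x[unfolded has_vector_derivative_def] _ st])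
  fix r assume "r \<in> I"
  from mult_left_mono[OF v[OF this], of "\<bar>h\<bar>" for h]
  have "norm (h *\<^sub>R v r) \<le> B * norm h" for h by (simp add: mult.commute)
  then show "onorm (\<lambda>h. h *\<^sub>R v r) \<le> B"
    using order_trans[OF norm_ge_zero v[OF st(1)]] by (intro onorm_bound) auto
qed

lemma has_vector_derivative_ac_solution:
  fixes x :: "real \<Rightarrow> 'a::banach"
  assumes x: "\<And>t. t \<in> {0..T} \<Longrightarrow> (x has_vector_derivative v t) (at t within {0..T})"
    and v: "continuous_on {0..T} v"
  shows "ac_solution T x v"
proof -
  have "compact (v ` {0..T})" using v by (intro compact_continuous_image) auto
  then obtain B where B: "\<And>t. t \<in> {0..T} \<Longrightarrow> norm (v t) \<le> B"
    using compact_imp_bounded bounded_iff by (metis imageI)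
  have "(max B 0)-lipschitz_on {0..T} x"
  proof (rule lipschitz_onI)
    fix s t assume st: "s \<in> {0..T}" "t \<in> {0..T}"
    have "norm (x s - x t) \<le> max B 0 * norm (s - t)"
      by (rule norm_increment_le_of_norm_derivative_le[OF _ x _ st]) (use B in \<open>auto simp: le_max_iff_disj\<close>)
    then show "dist (x s) (x t) \<le> max B 0 * dist s t" by (simp add: dist_norm)
  qed simp
  then have "abs_continuous_on {0..T} x" by (rule lipschitz_on_imp_abs_continuous_on)
  then show ?thesis unfolding ac_solution_iff using x by (blast intro: negligible_empty)
qed

lemma ac_solution_Pair:
  assumes x: "ac_solution T x v" and y: "ac_solution T y w"
  shows "ac_solution T (\<lambda>t. (x t, y t)) (\<lambda>t. (v t, w t))"
proof -
  obtain N M where N: "negligible N" "\<And>s. s \<in> {0..T} - N \<Longrightarrow> (x has_vector_derivative v s) (at s within {0..T})"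
    and M: "negligible M" "\<And>s. s \<in> {0..T} - M \<Longrightarrow> (y has_vector_derivative w s) (at s within {0..T})"
    using x y unfolding ac_solution_iff by blast
  have "abs_continuous_on {0..T} (\<lambda>t. (x t, y t))"
    using x y unfolding ac_solution_def
    by (auto intro!: abs_continuous_on_triangle[of _ x y] simp: norm_Pair sqrt_sum_squares_le_sum)
  moreover have "negligible (N \<union> M)" using N M by simp
  ultimately show ?thesis unfolding ac_solution_iff
    using N(2) M(2) by (blast intro: has_vector_derivative_Pair)
qed

lemma ac_solution_compose:
  fixes F :: "'a::euclidean_space \<Rightarrow> 'b::real_normed_vector"
  assumes F: "C1 F" and x: "ac_solution T x v"
  shows "ac_solution T (\<lambda>t. F (x t)) (\<lambda>t. frechet_derivative F (at (x t)) (v t))"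
proof -
  obtain N where N: "negligible N" "\<And>s. s \<in> {0..T} - N \<Longrightarrow> (x has_vector_derivative v s) (at s within {0..T})"
    using x unfolding ac_solution_iff by blast
  have "compact (x ` {0..T})"
    using ac_solution_continuous_on[OF x] by (intro compact_continuous_image) auto
  then obtain R where R: "\<And>t. t \<in> {0..T} \<Longrightarrow> norm (x t) \<le> R"
    using compact_imp_bounded bounded_iff by (metis imageI)
  obtain K where K: "K-lipschitz_on (cball 0 R) F" "K > 0"
    using lipschitz_on_ballsE[OF lipschitz_on_balls_C1[OF F]] by blast
  have "abs_continuous_on {0..T} (\<lambda>t. F (x t))"
  proof (rule abs_continuous_on_mono)
    show "abs_continuous_on {0..T} x" using x by (simp add: ac_solution_def)
    show "norm (F (x s) - F (x t)) \<le> K * norm (x s - x t)" if "s \<in> {0..T}" "t \<in> {0..T}" for s t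
      using lipschitz_on_normD[OF K(1), of "x s" "x t"] R that by simp
  qed (use K in simp)
  moreover have "((\<lambda>t. F (x t)) has_vector_derivative frechet_derivative F (at (x s)) (v s))
      (at s within {0..T})" if "s \<in> {0..T} - N" for s
  proof -
    have d: "(F has_derivative frechet_derivative F (at (x s))) (at (x s) within x ` {0..T})"
      using C1_has_derivative[OF F] by (rule has_derivative_at_withinI)
    then show ?thesis
      using diff_chain_within[OF N(2)[OF that, unfolded has_vector_derivative_def] d]
      by (simp add: has_vector_derivative_def o_def linear_scale has_derivative_linear)
  qed
  ultimately show ?thesis using N(1) unfolding ac_solution_iff by blast
qed

lemma C1_bounded_linear:
  assumes "bounded_linear A" shows "C1 A"
  unfolding C1_def
proof (intro exI[of _ "\<lambda>_. Blinfun A"] conjI allI continuous_on_const)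
  show "(A has_derivative blinfun_apply (Blinfun A)) (at x)" for x
    unfolding bounded_linear_Blinfun_apply[OF assms] using assms by (rule bounded_linear_imp_has_derivative)
qed

lemma C1_half_norm_sq: "C1 (\<lambda>e::'a::real_inner. 1/2 * (norm e)\<^sup>2)"
  and frechet_derivative_half_norm_sq:
    "frechet_derivative (\<lambda>e::'a. 1/2 * (norm e)\<^sup>2) (at e) = (\<lambda>h. e \<bullet> h)"
proof -
  have d: "((\<lambda>e::'a. 1/2 * (norm e)\<^sup>2) has_derivative (\<lambda>h. e \<bullet> h)) (at e)" for e
    unfolding power2_norm_eq_inner
    by (auto intro!: derivative_eq_intros simp: fun_eq_iff inner_commute)
  then have "((\<lambda>e::'a. 1/2 * (norm e)\<^sup>2) has_derivative blinfun_apply (blinfun_inner_right e)) (at e)" for e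
    by simp
  moreover have "continuous_on UNIV (blinfun_inner_right :: 'a \<Rightarrow> _)"
    by (intro linear_continuous_on bounded_linear_blinfun_inner_right)
  ultimately show "C1 (\<lambda>e::'a. 1/2 * (norm e)\<^sup>2)" unfolding C1_def by blast
  show "frechet_derivative (\<lambda>e::'a. 1/2 * (norm e)\<^sup>2) (at e) = (\<lambda>h. e \<bullet> h)"
    by (rule frechet_derivative_at[OF d, symmetric])
qed

lemma ac_solution_bounded_linear:
  fixes A :: "'a::euclidean_space \<Rightarrow> 'b::real_normed_vector"
  assumes "bounded_linear A" "ac_solution T x v"
  shows "ac_solution T (\<lambda>t. A (x t)) (\<lambda>t. A (v t))"
  using ac_solution_compose[OF C1_bounded_linear[OF assms(1)] assms(2)]
  unfolding frechet_derivative_at[OF bounded_linear_imp_has_derivative[OF assms(1)], symmetric] .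

lemma ac_solution_add:
  fixes x y :: "real \<Rightarrow> 'a::euclidean_space"
  assumes "ac_solution T x v" "ac_solution T y w"
  shows "ac_solution T (\<lambda>t. x t + y t) (\<lambda>t. v t + w t)"
proof -
  have "bounded_linear (\<lambda>p::'a \<times> 'a. fst p + snd p)"
    by (intro bounded_linear_add bounded_linear_fst bounded_linear_snd)
  from ac_solution_bounded_linear[OF this ac_solution_Pair[OF assms]] show ?thesis by simp
qed

lemma ac_solution_diff:
  fixes x y :: "real \<Rightarrow> 'a::euclidean_space"
  assumes "ac_solution T x v" "ac_solution T y w"
  shows "ac_solution T (\<lambda>t. x t - y t) (\<lambda>t. v t - w t)"
proof -
  have "bounded_linear (\<lambda>p::'a \<times> 'a. fst p - snd p)"
    by (intro bounded_linear_sub bounded_linear_fst bounded_linear_snd)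
  from ac_solution_bounded_linear[OF this ac_solution_Pair[OF assms]] show ?thesis by simp
qed

section \<open>Balance between storage and cost\<close>

lemma nn_integral_lebesgue_on_has_integral:
  fixes h :: "real \<Rightarrow> real"
  assumes h: "(h has_integral I) S" and nn: "\<And>t. t \<in> S \<Longrightarrow> 0 \<le> h t" and S: "S \<in> sets lebesgue"
  shows "(\<integral>\<^sup>+ t. ennreal (h t) \<partial>lebesgue_on S) = ennreal I"
proof -
  have int: "integrable (lebesgue_on S) h"
    using h nn S by (intro absolutely_integrable_imp_integrable nonnegative_absolutely_integrable_1) auto
  have "(\<integral>\<^sup>+ t. ennreal (h t) \<partial>lebesgue_on S) = ennreal (integral\<^sup>L (lebesgue_on S) h)"
    using nn by (intro nn_integral_eq_integral[OF int] AE_I2) simp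
  also have "integral\<^sup>L (lebesgue_on S) h = I"
    using has_integral_unique[OF has_integral_integral_lebesgue_on[OF int S] h] .
  finally show ?thesis .
qed

lemma has_integral_nn_integral_finite:
  fixes h :: "real \<Rightarrow> real"
  assumes meas: "h \<in> borel_measurable (lebesgue_on S)" and nn: "\<And>t. t \<in> S \<Longrightarrow> 0 \<le> h t"
    and S: "S \<in> sets lebesgue" and fin: "(\<integral>\<^sup>+ t. ennreal (h t) \<partial>lebesgue_on S) < \<infinity>"
  obtains I where "(h has_integral I) S"
proof -
  have "integrable (lebesgue_on S) h"
    using nn fin by (intro integrableI_nonneg[OF meas] AE_I2) auto
  from has_integral_integral_lebesgue_on[OF this S] show thesis by (rule that)
qed

lemma nn_integral_balance_aux:
  fixes r s :: "real \<Rightarrow> real"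
  assumes w: "((\<lambda>t. s t - r t) has_integral d) S" and S: "S \<in> sets lebesgue"
    and r: "r \<in> borel_measurable (lebesgue_on S)"
    and nn: "\<And>t. t \<in> S \<Longrightarrow> 0 \<le> r t" "\<And>t. t \<in> S \<Longrightarrow> 0 \<le> s t"
    and fin: "(\<integral>\<^sup>+ t. ennreal (r t) \<partial>lebesgue_on S) < \<infinity>"
  shows "ereal d + enn2ereal (\<integral>\<^sup>+ t. ennreal (r t) \<partial>lebesgue_on S)
      = enn2ereal (\<integral>\<^sup>+ t. ennreal (s t) \<partial>lebesgue_on S)"
proof -
  obtain I where I: "(r has_integral I) S"
    using has_integral_nn_integral_finite[OF r nn(1) S fin] by blast
  from has_integral_add[OF w I] have J: "(s has_integral d + I) S" by simp
  have "0 \<le> I" "0 \<le> d + I"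
    using has_integral_nonneg[OF I nn(1)] has_integral_nonneg[OF J nn(2)] by auto
  then show ?thesis
    by (simp add: nn_integral_lebesgue_on_has_integral[OF I nn(1) S]
        nn_integral_lebesgue_on_has_integral[OF J nn(2) S] enn2ereal_ennreal)
qed

text \<open>The dissipation identity in the extended reals. If either integral is finite, then \<open>s -
r\<close> being gauge integrable makes the other function gauge integrable as well, hence Lebesgue integrable
because it is nonnegative. If both are infinite, both sides are \<open>\<infinity>\<close>.\<close>
theorem ac_solution_cost_balance:
  fixes W r s :: "real \<Rightarrow> real"
  assumes W: "ac_solution T W (\<lambda>t. s t - r t)" and "0 \<le> T"
    and r: "r \<in> borel_measurable (lebesgue_on {0..T})"
    and nn: "\<And>t. t \<in> {0..T} \<Longrightarrow> 0 \<le> r t" "\<And>t. t \<in> {0..T} \<Longrightarrow> 0 \<le> s t"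
  shows "s \<in> borel_measurable (lebesgue_on {0..T})"
    and "ereal (W T) + enn2ereal (\<integral>\<^sup>+ t. ennreal (r t) \<partial>lebesgue_on {0..T})
      = ereal (W 0) + enn2ereal (\<integral>\<^sup>+ t. ennreal (s t) \<partial>lebesgue_on {0..T})"
proof -
  let ?R = "\<integral>\<^sup>+ t. ennreal (r t) \<partial>lebesgue_on {0..T}"
  let ?S = "\<integral>\<^sup>+ t. ennreal (s t) \<partial>lebesgue_on {0..T}"
  have w: "((\<lambda>t. s t - r t) has_integral W T - W 0) {0..T}"
    using ac_solution_has_integral[OF W] \<open>0 \<le> T\<close> by auto
  then have w': "((\<lambda>t. r t - s t) has_integral W 0 - W T) {0..T}"
    using has_integral_neg[OF w] by simp
  have "(\<lambda>t. s t - r t) \<in> borel_measurable (lebesgue_on {0..T})"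
    using w by (intro integrable_imp_measurable) auto
  from borel_measurable_add[OF this r] show s: "s \<in> borel_measurable (lebesgue_on {0..T})"
    by simp
  have I: "{0..T} \<in> sets lebesgue" by simp
  consider "?R < \<infinity>" | "?S < \<infinity>" | "?R = \<infinity>" "?S = \<infinity>"
    by (metis infinity_ennreal_def less_top)
  then show "ereal (W T) + enn2ereal ?R = ereal (W 0) + enn2ereal ?S"
  proof cases
    case 1
    have "ereal (W 0) + enn2ereal ?S = ereal (W 0) + (ereal (W T - W 0) + enn2ereal ?R)"
      using nn_integral_balance_aux[OF w I r nn 1] by simp
    then show ?thesis by (simp flip: add.assoc)
  next
    case 2
    have "ereal (W T) + enn2ereal ?R = ereal (W T) + (ereal (W 0 - W T) + enn2ereal ?S)"
      using nn_integral_balance_aux[OF w' I s nn(2,1) 2] by simp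
    then show ?thesis by (simp flip: add.assoc)
  next
    case 3
    then show ?thesis by simp
  qed
qed

section \<open>Differential inequalities and differential equations\<close>

lemma increment_le_of_derivative_le:
  fixes g :: "real \<Rightarrow> real"
  assumes der: "\<And>r. r \<in> {s..t} \<Longrightarrow> (g has_real_derivative g' r) (at r within I)"
    and "s \<le> t" "{s..t} \<subseteq> I" and le: "\<And>r. r \<in> {s..t} \<Longrightarrow> g' r \<le> B"
  shows "g t - g s \<le> B * (t - s)"
proof -
  have "(g' has_integral g t - g s) {s..t}"
    using der assms(3) by (intro fundamental_theorem_of_calculus[OF \<open>s \<le> t\<close>])
      (auto simp: has_real_derivative_iff_has_vector_derivative intro: has_vector_derivative_within_subset)
  from has_integral_le[OF this has_integral_const_real[of B s t] le] \<open>s \<le> t\<close>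
  show ?thesis by (simp add: mult.commute)
qed

text \<open>With \<open>d = x - y\<close>, the function \<open>|d|\<^sup>2 exp(-2Kt)\<close> has nonpositive
derivative and starts at \<open>0\<close>. The rates \<open>v\<close> and \<open>w\<close> are arbitrary
functions of time, so that systems driven by an external signal are covered.\<close>
lemma gronwall_unique:
  fixes x y :: "real \<Rightarrow> 'a::real_inner"
  assumes x: "\<And>t. t \<in> {0..T} \<Longrightarrow> (x has_vector_derivative v t) (at t within {0..T})"
    and y: "\<And>t. t \<in> {0..T} \<Longrightarrow> (y has_vector_derivative w t) (at t within {0..T})"
    and lip: "\<And>t. t \<in> {0..T} \<Longrightarrow> norm (v t - w t) \<le> K * norm (x t - y t)"
    and "x 0 = y 0" and t: "t \<in> {0..T}"
  shows "x t = y t"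
proof -
  define d where "d t = x t - y t" for t
  define g where "g t = (d t \<bullet> d t) * exp (- 2 * K * t)" for t
  have "g t - g 0 \<le> 0 * (t - 0)"
  proof (rule increment_le_of_derivative_le[where I = "{0..T}"])
    fix r assume r: "r \<in> {0..t}"
    then have r': "r \<in> {0..T}" using t by auto
    have d: "(d has_derivative (\<lambda>h. h *\<^sub>R (v r - w r))) (at r within {0..T})"
      using has_vector_derivative_diff[OF x[OF r'] y[OF r']]
      unfolding d_def has_vector_derivative_def .
    show "(g has_real_derivative (2 * (d r \<bullet> (v r - w r)) - 2 * K * (d r \<bullet> d r)) * exp (- 2 * K * r))
        (at r within {0..T})"
      unfolding g_def has_field_derivative_def
      by (rule has_derivative_eq_rhs, (rule derivative_eq_intros d refl)+)
        (auto simp: fun_eq_iff algebra_simps inner_commute)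
    have "d r \<bullet> (v r - w r) \<le> norm (d r) * norm (v r - w r)"
      by (rule norm_cauchy_schwarz)
    also have "\<dots> \<le> norm (d r) * (K * norm (d r))"
      using lip[OF r'] by (intro mult_left_mono) (auto simp: d_def)
    also have "\<dots> = K * (d r \<bullet> d r)"
      by (simp add: power2_norm_eq_inner[symmetric] power2_eq_square)
    finally show "(2 * (d r \<bullet> (v r - w r)) - 2 * K * (d r \<bullet> d r)) * exp (- 2 * K * r) \<le> 0"
      by (intro mult_nonpos_nonneg) auto
  qed (use t in auto)
  moreover have "g 0 = 0" using \<open>x 0 = y 0\<close> by (simp add: g_def d_def)
  ultimately have "d t \<bullet> d t \<le> 0"
    by (simp add: g_def mult_le_0_iff)
  then show ?thesis using inner_ge_zero[of "d t"] by (simp add: d_def del: inner_ge_zero)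
qed

lemma ode_unique:
  fixes F :: "'a::euclidean_space \<Rightarrow> 'a"
  assumes F: "lipschitz_on_balls F"
    and x: "\<And>t. t \<in> {0..T} \<Longrightarrow> (x has_vector_derivative F (x t)) (at t within {0..T})"
    and y: "\<And>t. t \<in> {0..T} \<Longrightarrow> (y has_vector_derivative F (y t)) (at t within {0..T})"
    and "x 0 = y 0" and t: "t \<in> {0..T}"
  shows "x t = y t"
proof -
  have "continuous_on {0..T} x" "continuous_on {0..T} y"
    using continuous_on_vector_derivative[OF x] continuous_on_vector_derivative[OF y] by auto
  then have "bounded (x ` {0..T} \<union> y ` {0..T})"
    by (intro bounded_Un[THEN iffD2] conjI compact_imp_bounded compact_continuous_image) auto
  then obtain R where R: "\<And>p. p \<in> x ` {0..T} \<union> y ` {0..T} \<Longrightarrow> norm p \<le> R"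
    unfolding bounded_iff by blast
  obtain K where K: "K-lipschitz_on (cball 0 R) F"
    using lipschitz_on_ballsE[OF F] by blast
  show ?thesis
  proof (rule gronwall_unique[OF x y _ \<open>x 0 = y 0\<close> t])
    show "norm (F (x s) - F (y s)) \<le> K * norm (x s - y s)" if "s \<in> {0..T}" for s
      using lipschitz_on_normD[OF K, of "x s" "y s"] R that by simp
  qed
qed

lemma bcontfun_clamp:
  fixes h :: "real \<Rightarrow> 'a::real_normed_vector"
  assumes h: "continuous_on {0..T} h" and "0 \<le> T"
  shows "(\<lambda>t. h (max 0 (min t T))) \<in> bcontfun"
proof -
  have "compact (h ` {0..T})" using h by (intro compact_continuous_image) auto
  then obtain B where B: "\<And>t. t \<in> {0..T} \<Longrightarrow> norm (h t) \<le> B"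
    using compact_imp_bounded bounded_iff by (metis imageI)
  show ?thesis
  proof (rule bcontfun_normI)
    show "continuous_on UNIV (\<lambda>t. h (max 0 (min t T)))"
      using \<open>0 \<le> T\<close> by (intro continuous_on_compose2[OF h] continuous_intros) auto
    show "norm (h (max 0 (min t T))) \<le> B" for t
      using B \<open>0 \<le> T\<close> by auto
  qed
qed

text \<open>Global solutions for a globally Lipschitz field, in one application of the contraction principle:
after the substitution \<open>y t = exp (k t) w t\<close> with \<open>k > 2 K\<close>, the integral operator
contracts the supremum norm by the factor \<open>K / k < 1/2\<close>, however large \<open>T\<close> is. The
space of bounded continuous functions lives on the whole line, so the operator freezes time outside
\<open>{0..T}\<close>.\<close>
theorem picard_lindeloef_global:
  fixes G :: "'a::euclidean_space \<Rightarrow> 'a"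
  assumes G: "K-lipschitz_on UNIV G" and "0 \<le> T"
  obtains y where "y 0 = y0"
    "\<And>t. t \<in> {0..T} \<Longrightarrow> (y has_vector_derivative G (y t)) (at t within {0..T})"
proof -
  define k where "k = 2 * K + 1"
  have "K \<ge> 0" using lipschitz_on_nonneg[OF G] .
  then have "k > 0" by (simp add: k_def)
  have Gc: "continuous_on UNIV G" using lipschitz_on_continuous_on[OF G] .
  define P where "P w t = exp (- k * t) *\<^sub>R (y0 + integral {0..t} (\<lambda>s. G (exp (k * s) *\<^sub>R w s)))"
    for w :: "real \<Rightarrow> 'a" and t
  have cont: "continuous_on {0..t} (\<lambda>s. G (exp (k * s) *\<^sub>R apply_bcontfun w s))" for w t
    by (intro continuous_on_compose2[OF Gc] continuous_intros) auto
  have P_cont: "continuous_on {0..T} (P (apply_bcontfun w))" for w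
    unfolding P_def
    by (intro continuous_intros indefinite_integral_continuous_1 integrable_continuous_real cont)
  define \<Phi> where "\<Phi> w = Bcontfun (\<lambda>t. P (apply_bcontfun w) (max 0 (min t T)))" for w
  have \<Phi>: "apply_bcontfun (\<Phi> w) t = P (apply_bcontfun w) (max 0 (min t T))" for w t
    unfolding \<Phi>_def by (simp add: Bcontfun_inverse bcontfun_clamp[OF P_cont \<open>0 \<le> T\<close>])
  have "dist (\<Phi> w) (\<Phi> v) \<le> 1 / 2 * dist w v" for w v
  proof (rule dist_bound)
    fix t
    define c where "c = max 0 (min t T)"
    have "c \<ge> 0" by (simp add: c_def)
    let ?I = "\<lambda>w. \<lambda>s. G (exp (k * s) *\<^sub>R apply_bcontfun w s)"
    have int: "?I w integrable_on {0..c}" for w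
      by (rule integrable_continuous_real[OF cont])
    have bound: "((\<lambda>s. K * dist w v * exp (k * s)) has_integral
        K * dist w v / k * exp (k * c) - K * dist w v / k * exp (k * 0)) {0..c}"
      using \<open>k > 0\<close> \<open>c \<ge> 0\<close>
      by (intro fundamental_theorem_of_calculus)
        (auto simp flip: has_real_derivative_iff_has_vector_derivative intro!: derivative_eq_intros)
    have "norm (integral {0..c} (\<lambda>s. ?I w s - ?I v s)) \<le> integral {0..c} (\<lambda>s. K * dist w v * exp (k * s))"
    proof (rule integral_norm_bound_integral)
      show "(\<lambda>s. ?I w s - ?I v s) integrable_on {0..c}" by (intro integrable_diff int)
      show "(\<lambda>s. K * dist w v * exp (k * s)) integrable_on {0..c}" using bound by blast
      show "norm (?I w s - ?I v s) \<le> K * dist w v * exp (k * s)" for s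
      proof -
        have "norm (?I w s - ?I v s)
            \<le> K * norm (exp (k * s) *\<^sub>R apply_bcontfun w s - exp (k * s) *\<^sub>R apply_bcontfun v s)"
          by (rule lipschitz_on_normD[OF G]) auto
        also have "\<dots> = K * (exp (k * s) * dist (apply_bcontfun w s) (apply_bcontfun v s))"
          by (simp add: dist_norm flip: scaleR_diff_right)
        also have "\<dots> \<le> K * (exp (k * s) * dist w v)"
          using \<open>K \<ge> 0\<close> by (intro mult_left_mono dist_bounded) auto
        finally show ?thesis by (simp add: algebra_simps)
      qed
    qed
    also have "\<dots> = K * dist w v / k * (exp (k * c) - 1)"
      unfolding integral_unique[OF bound] by (simp add: right_diff_distrib)
    also have "\<dots> \<le> K * dist w v / k * exp (k * c)"
      using \<open>k > 0\<close> \<open>K \<ge> 0\<close> by (intro mult_left_mono) auto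
    finally have *: "norm (integral {0..c} (\<lambda>s. ?I w s - ?I v s)) \<le> K * dist w v / k * exp (k * c)" .
    have "dist (\<Phi> w t) (\<Phi> v t) = exp (- k * c) * norm (integral {0..c} (\<lambda>s. ?I w s - ?I v s))"
      unfolding \<Phi> c_def[symmetric] P_def integral_diff[OF int int] dist_norm
      by (simp flip: scaleR_diff_right)
    also have "\<dots> \<le> exp (- k * c) * (K * dist w v / k * exp (k * c))"
      using * by (intro mult_left_mono) auto
    also have "\<dots> = K / k * dist w v" by (simp add: exp_minus field_simps)
    also have "\<dots> \<le> 1 / 2 * dist w v"
      using \<open>K \<ge> 0\<close> by (intro mult_right_mono) (auto simp: k_def field_simps)
    finally show "dist (\<Phi> w t) (\<Phi> v t) \<le> 1 / 2 * dist w v" .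
  qed
  then obtain w where w: "\<Phi> w = w"
    using banach_fix_type[of "1/2" \<Phi>] by auto
  define y where "y t = exp (k * t) *\<^sub>R apply_bcontfun w t" for t
  have y: "y t = y0 + integral {0..t} (\<lambda>s. G (y s))" if "t \<in> {0..T}" for t
  proof -
    have "apply_bcontfun w t = P (apply_bcontfun w) t"
      using \<Phi>[of w t] that by (simp add: w min_absorb1 max_absorb2)
    then show ?thesis
      by (simp add: y_def P_def exp_minus)
  qed
  show thesis
  proof (rule that[of y])
    show "y 0 = y0" using y[of 0] \<open>0 \<le> T\<close> by simp
    fix t assume t: "t \<in> {0..T}"
    have "((\<lambda>s. y0 + integral {0..s} (\<lambda>s. G (y s))) has_vector_derivative 0 + G (y t)) (at t within {0..T})"
      using cont[of T w] t unfolding y_def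
      by (intro has_vector_derivative_add integral_has_vector_derivative) auto
    then show "(y has_vector_derivative G (y t)) (at t within {0..T})"
      unfolding add_0 by (rule has_vector_derivative_transform[OF t, rotated]) (use y in auto)
  qed
qed

text \<open>Composing \<open>F\<close> with the projection onto a ball slightly larger than the a priori bound
gives a globally Lipschitz field. Its solution obeys the original equation up to the first time it reaches the
boundary of the ball, and the a priori bound at that time shows that it never does.\<close>
theorem ode_exists_of_a_priori_bound:
  fixes F :: "'a::euclidean_space \<Rightarrow> 'a"
  assumes F: "lipschitz_on_balls F" and "0 \<le> T"
    and bound: "\<And>\<tau> y. 0 \<le> \<tau> \<Longrightarrow> \<tau> \<le> T \<Longrightarrow> y 0 = y0 \<Longrightarrow>
      (\<And>t. t \<in> {0..\<tau>} \<Longrightarrow> (y has_vector_derivative F (y t)) (at t within {0..\<tau>})) \<Longrightarrow> norm (y \<tau>) \<le> R"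
  obtains y where "y 0 = y0"
    "\<And>t. t \<in> {0..T} \<Longrightarrow> (y has_vector_derivative F (y t)) (at t within {0..T})"
proof -
  define M where "M = max R (norm y0) + 1"
  have M: "R < M" "norm y0 < M" by (auto simp: M_def)
  then have "0 < M" using norm_ge_zero[of y0] by linarith
  let ?B = "cball (0::'a) M"
  have B: "convex ?B" "closed ?B" "?B \<noteq> {}" using \<open>0 < M\<close> by auto
  obtain K where K: "K-lipschitz_on ?B F" using lipschitz_on_ballsE[OF F] by blast
  define G where "G p = F (closest_point ?B p)" for p
  have G: "G p = F p" if "norm p \<le> M" for p
    using that by (simp add: G_def closest_point_self)
  have "K-lipschitz_on UNIV G"
  proof (rule lipschitz_onI)
    fix p r :: 'a
    have "dist (G p) (G r) \<le> K * dist (closest_point ?B p) (closest_point ?B r)"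
      unfolding G_def using closest_point_in_set[OF B(2,3)] by (intro lipschitz_onD[OF K])
    also have "\<dots> \<le> K * dist p r"
      using closest_point_lipschitz[OF B] lipschitz_on_nonneg[OF K] by (intro mult_left_mono)
    finally show "dist (G p) (G r) \<le> K * dist p r" .
  qed (use lipschitz_on_nonneg[OF K] in auto)
  then obtain y where y0: "y 0 = y0" and
    y: "\<And>t. t \<in> {0..T} \<Longrightarrow> (y has_vector_derivative G (y t)) (at t within {0..T})"
    using picard_lindeloef_global \<open>0 \<le> T\<close> by metis
  have yc: "continuous_on {0..T} (\<lambda>t. norm (y t))"
    using y by (intro continuous_on_norm continuous_on_vector_derivative)
  have inside: "norm (y t) \<le> M" if t: "t \<in> {0..T}" for t
  proof (rule ccontr)
    assume "\<not> norm (y t) \<le> M"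
    define S where "S = {s \<in> {0..t}. norm (y s) = M}"
    have yct: "continuous_on {0..s} (\<lambda>t. norm (y t))" if "s \<le> t" for s
      using yc t that continuous_on_subset by fastforce
    \<comment> \<open>By the intermediate value theorem, a trajectory outside the ball has crossed its boundary.\<close>
    have crossing: "\<exists>r\<in>{0..s}. norm (y r) = M" if "s \<in> {0..t}" "norm (y s) \<ge> M" for s
      using IVT'[of "\<lambda>t. norm (y t)" 0 M s] yct[of s] that M y0 by auto
    have "S \<noteq> {}" using crossing[of t] t \<open>\<not> norm (y t) \<le> M\<close> by (auto simp: S_def)
    have "closed S"
      using continuous_closed_preimage_constant[OF yct[of t], of M] by (simp add: S_def)
    moreover have "bounded S" by (rule bounded_subset[of "{0..t}"]) (auto simp: S_def)
    ultimately have "compact S" by (simp add: compact_eq_bounded_closed)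
    then obtain \<tau> where \<tau>: "\<tau> \<in> S" and first: "\<And>s. s \<in> S \<Longrightarrow> \<tau> \<le> s"
      using compact_attains_inf[OF _ \<open>S \<noteq> {}\<close>] by blast
    \<comment> \<open>Up to the first crossing time the truncation is inactive.\<close>
    have le: "norm (y s) \<le> M" if s: "s \<in> {0..\<tau>}" for s
    proof (rule ccontr)
      assume "\<not> norm (y s) \<le> M"
      then obtain r where "r \<in> {0..s}" "norm (y r) = M"
        using crossing[of s] s \<tau> by (auto simp: S_def)
      moreover have "r = s" using first[of r] calculation s \<tau> by (auto simp: S_def)
      ultimately show False using \<open>\<not> norm (y s) \<le> M\<close> by simp
    qed
    have "norm (y \<tau>) \<le> R"
    proof (rule bound[where y = y, OF _ _ y0])
      fix s assume s: "s \<in> {0..\<tau>}"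
      then have "(y has_vector_derivative G (y s)) (at s within {0..\<tau>})"
        using \<tau> t by (intro has_vector_derivative_within_subset[OF y[of s]]) (auto simp: S_def)
      then show "(y has_vector_derivative F (y s)) (at s within {0..\<tau>})"
        using G[OF le[OF s]] by simp
    qed (use \<tau> t in \<open>auto simp: S_def\<close>)
    then show False using \<tau> M by (simp add: S_def)
  qed
  show thesis
  proof (rule that[of y])
    fix t assume "t \<in> {0..T}"
    with y G[OF inside] show "(y has_vector_derivative F (y t)) (at t within {0..T})" by simp
  qed fact
qed


section \<open>Gradient bounds and a Barbalat lemma\<close>

text \<open>A gradient step of length \<open>1 / (2 K)\<close> decreases \<open>f\<close> by at least
\<open>|g x|\<^sup>2 / (4 K)\<close>, since the gradient keeps at least half of its component along \<open>g
x\<close> on the way; the lower bound \<open>m\<close> limits this decrease.\<close>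
lemma norm_gradient_sq_le:
  fixes f :: "'a::real_inner \<Rightarrow> real"
  assumes der: "\<And>x. (f has_derivative (\<lambda>h. g x \<bullet> h)) (at x)"
    and lip: "\<And>x y. norm (g x - g y) \<le> K * norm (x - y)" and "K > 0"
    and lower: "\<And>x. m \<le> f x"
  shows "(norm (g x))\<^sup>2 \<le> 4 * K * (f x - m)"
proof -
  define s where "s = 1 / (2 * K)"
  have "s > 0" using \<open>K > 0\<close> by (simp add: s_def)
  have "f (x - s *\<^sub>R g x) - f (x - 0 *\<^sub>R g x) \<le> - ((norm (g x))\<^sup>2 / 2) * (s - 0)"
  proof (rule increment_le_of_derivative_le[where I = UNIV])
    fix r assume r: "r \<in> {0..s}"
    have line: "((\<lambda>r. x - r *\<^sub>R g x) has_derivative (\<lambda>h. - (h *\<^sub>R g x))) (at r)"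
      by (auto intro!: derivative_eq_intros)
    show "((\<lambda>r. f (x - r *\<^sub>R g x)) has_real_derivative - (g (x - r *\<^sub>R g x) \<bullet> g x)) (at r)"
      unfolding has_field_derivative_def
      by (rule has_derivative_eq_rhs[OF has_derivative_compose[OF line der]]) (auto simp: fun_eq_iff)
    have "g x \<bullet> g x - g (x - r *\<^sub>R g x) \<bullet> g x = (g x - g (x - r *\<^sub>R g x)) \<bullet> g x"
      by (simp add: inner_diff_left)
    also have "\<dots> \<le> norm (g x - g (x - r *\<^sub>R g x)) * norm (g x)"
      by (rule norm_cauchy_schwarz)
    also have "\<dots> \<le> (K * (r * norm (g x))) * norm (g x)"
      using lip[of x "x - r *\<^sub>R g x"] r by (intro mult_right_mono) auto
    also have "\<dots> = (K * r) * (norm (g x))\<^sup>2" by (simp add: power2_eq_square)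
    also have "\<dots> \<le> 1 / 2 * (norm (g x))\<^sup>2"
      using r \<open>K > 0\<close> by (intro mult_right_mono) (auto simp: s_def field_simps)
    finally show "- (g (x - r *\<^sub>R g x) \<bullet> g x) \<le> - ((norm (g x))\<^sup>2 / 2)"
      by (simp add: power2_norm_eq_inner)
  qed (use \<open>s > 0\<close> in auto)
  with lower[of "x - s *\<^sub>R g x"] have "(norm (g x))\<^sup>2 / 2 * s \<le> f x - m" by simp
  then show ?thesis using \<open>K > 0\<close> by (simp add: s_def field_simps)
qed

text \<open>If \<open>g t \<ge> \<epsilon>\<close>, then \<open>g \<ge> \<epsilon> / 2\<close> on \<open>[t, t
+ \<epsilon> / (2 M)]\<close>, and \<open>W\<close> drops there by a fixed amount. Once \<open>W\<close> is
closer than that amount to its infimum, this is impossible. The hypothesis \<open>decay\<close> says that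
\<open>W\<close> decreases at rate at least \<open>k g\<^sup>2\<close>, without asking for
differentiability.\<close>
lemma barbalat_dissipation:
  fixes W g :: "real \<Rightarrow> real"
  assumes lower: "\<And>t. 0 \<le> t \<Longrightarrow> 0 \<le> W t"
    and decay: "\<And>s t b. 0 \<le> s \<Longrightarrow> s \<le> t \<Longrightarrow> 0 \<le> b \<Longrightarrow> (\<And>r. r \<in> {s..t} \<Longrightarrow> b \<le> g r) \<Longrightarrow>
      W t \<le> W s - k * b\<^sup>2 * (t - s)"
    and "k > 0" and nonneg: "\<And>t. 0 \<le> t \<Longrightarrow> 0 \<le> g t"
    and lip: "\<And>s t. 0 \<le> s \<Longrightarrow> s \<le> t \<Longrightarrow> \<bar>g t - g s\<bar> \<le> M * (t - s)" and "M > 0"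
  shows "(g \<longlongrightarrow> 0) at_top"
proof (rule tendstoI)
  fix \<epsilon> :: real assume "\<epsilon> > 0"
  define h where "h = \<epsilon> / (2 * M)"
  define d where "d = k * (\<epsilon> / 2)\<^sup>2 * h"
  have "h > 0" "d > 0" using \<open>\<epsilon> > 0\<close> \<open>M > 0\<close> \<open>k > 0\<close> by (auto simp: h_def d_def)
  let ?m = "INF t\<in>{0..}. W t"
  have bdd: "bdd_below (W ` {0..})" using lower by (auto intro!: bdd_belowI[of _ 0])
  have "?m < ?m + d" using \<open>d > 0\<close> by simp
  then obtain t0 where t0: "0 \<le> t0" "W t0 < ?m + d"
    using cINF_less_iff[OF _ bdd] by (metis atLeast_iff empty_iff order_refl)
  have "g t < \<epsilon>" if "t0 \<le> t" for t
  proof (rule ccontr)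
    assume "\<not> g t < \<epsilon>"
    have "W t \<le> W t0" using decay[of t0 t 0] nonneg t0 that by simp
    moreover have "W (t + h) \<le> W t - k * (\<epsilon> / 2)\<^sup>2 * (t + h - t)"
    proof (rule decay)
      fix r assume r: "r \<in> {t..t + h}"
      have "M * (r - t) \<le> M * h" using r \<open>M > 0\<close> by simp
      also have "\<dots> = \<epsilon> / 2" using \<open>M > 0\<close> by (simp add: h_def)
      finally show "\<epsilon> / 2 \<le> g r" using lip[of t r] r t0 that \<open>\<not> g t < \<epsilon>\<close> by simp
    qed (use t0 that \<open>h > 0\<close> \<open>\<epsilon> > 0\<close> in auto)
    ultimately have "W (t + h) < ?m" using t0 by (simp add: d_def)
    moreover have "?m \<le> W (t + h)" using t0 that \<open>h > 0\<close> by (intro cINF_lower[OF bdd]) auto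
    ultimately show False by simp
  qed
  then show "\<forall>\<^sub>F t in at_top. dist (g t) 0 < \<epsilon>"
    using nonneg t0 unfolding eventually_at_top_linorder
    by (intro exI[of _ t0]) auto
qed

section \<open>Consequences of the Hamilton--Jacobi--Bellman equation\<close>

lemma ennreal_shift_le_iff:
  "ereal v \<le> ereal v + enn2ereal s" "ereal v + enn2ereal s \<le> ereal v \<longleftrightarrow> s = 0"
proof -
  show le: "ereal v \<le> ereal v + enn2ereal s"
    using add_left_mono[OF enn2ereal_nonneg, of "ereal v" s] by simp
  show "ereal v + enn2ereal s \<le> ereal v \<longleftrightarrow> s = 0"
    using enn2ereal_nonneg[of s] enn2ereal_inject[of s 0]
    by (cases "enn2ereal s") (auto simp: zero_ennreal.rep_eq)
qed

text \<open>With \<open>e\<close> the tracking error and \<open>w = u - \<alpha>_dot + lam \<nabla>f\<close>,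
the vector \<open>w + c e\<close> is \<open>u - u_star\<close>; this square is what makes the outer running
cost inverse optimal for \<open>u_star\<close>.\<close>
lemma completing_square:
  fixes w e :: "'a::real_inner"
  assumes "c > 0"
  shows "1 / (2 * c) * (norm (w + c *\<^sub>R e))\<^sup>2
      = 1 / (2 * c) * (norm w)\<^sup>2 + e \<bullet> w + c / 2 * (norm e)\<^sup>2"
proof -
  have "(norm (w + c *\<^sub>R e))\<^sup>2 = (norm w)\<^sup>2 + 2 * c * (e \<bullet> w) + c\<^sup>2 * (norm e)\<^sup>2"
    unfolding power2_norm_eq_inner
    by (simp add: inner_add_left inner_add_right inner_commute[of w e] power2_eq_square distrib_left mult.assoc)
  with assms show ?thesis by (simp add: add_divide_distrib power2_eq_square)
qed

locale nested_hjb =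
  fixes f :: "real^'n \<Rightarrow> real"
    and q :: "(real^'n) \<times> (real^'m) \<Rightarrow> real^'m"
    and Lr :: "(real^'n) \<times> (real^'m) \<times> (real^'n) \<Rightarrow> real"
    and V1 :: "(real^'n) \<times> (real^'m) \<Rightarrow> real"
    and \<alpha> :: "(real^'n) \<times> (real^'m) \<Rightarrow> real^'n"
    and L c\<^sub>\<phi> c\<^sub>z lam \<sigma> c :: real
  assumes f_C2: "C2 f"
    and f_smooth: "\<forall>x y. norm (grad f x - grad f y) \<le> L * norm (x - y)"
    and f_bdd: "bdd_below (range f)"
    and q_lipschitz: "locally_lipschitz q"
    and Lr_nonneg: "\<forall>x1 z a. 0 \<le> Lr (x1, z, a)"
    and V1_C1: "C1 V1"
    and \<alpha>_C1: "C1 \<alpha>"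
    and consts_pos: "c\<^sub>\<phi> > 0" "c\<^sub>z > 0" "lam > 0" "\<sigma> > 0"
    and V1_lower: "\<forall>x1 z. V1 (x1, z) \<ge> c\<^sub>\<phi> * (f x1 - (INF y. f y)) + c\<^sub>z * (norm z)\<^sup>2"
    and V1_grad: "\<forall>x1 z. grad (\<lambda>x. V1 (x, z)) x1 = lam *\<^sub>R grad f x1"
    and HJB: "\<forall>x1 z. let H = (\<lambda>a. grad (\<lambda>x. V1 (x, z)) x1 \<bullet> a
                              + grad (\<lambda>y. V1 (x1, y)) z \<bullet> q (x1, z) + Lr (x1, z, a))
               in is_arg_min H (\<lambda>_. True) (\<alpha> (x1, z)) \<and> H (\<alpha> (x1, z)) = 0"
    and Lr_lower: "\<forall>x1 z. Lr (x1, z, \<alpha> (x1, z)) \<ge> \<sigma> * (norm (grad f x1))\<^sup>2"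
    and \<alpha>_bdd: "\<forall>R>0. bounded {\<alpha> (x1, z) | x1 z. norm (grad f x1) \<le> R \<and> norm z \<le> R}"
    and c_pos: "c > 0"
begin

abbreviation DV where "DV p \<equiv> frechet_derivative V1 (at p)"

abbreviation D\<alpha> where "D\<alpha> p \<equiv> frechet_derivative \<alpha> (at p)"

lemma f_has_derivative: "(f has_derivative (\<lambda>h. grad f x \<bullet> h)) (at x)"
proof -
  obtain f' where f': "(f has_derivative blinfun_apply (f' x)) (at x)"
    using f_C2 unfolding C2_def by blast
  moreover have "blinfun_apply (f' x) = (\<lambda>h. grad f x \<bullet> h)"
    using has_gradient[OF f'] by blast
  ultimately show ?thesis by simp
qed

lemma grad_lipschitz: "norm (grad f x - grad f y) \<le> (\<bar>L\<bar> + 1) * norm (x - y)"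
proof -
  have "norm (grad f x - grad f y) \<le> L * norm (x - y)" using f_smooth by blast
  also have "\<dots> \<le> (\<bar>L\<bar> + 1) * norm (x - y)" by (intro mult_right_mono) auto
  finally show ?thesis .
qed

lemma lipschitz_on_balls_grad: "lipschitz_on_balls (grad f)"
  unfolding lipschitz_on_balls_def
  by (intro allI exI[of _ "\<bar>L\<bar> + 1"] lipschitz_onI) (use grad_lipschitz in \<open>auto simp: dist_norm\<close>)

lemmas lipschitz_on_balls_q = lipschitz_on_balls_locally_lipschitz[OF q_lipschitz]
lemmas lipschitz_on_balls_\<alpha> = lipschitz_on_balls_C1[OF \<alpha>_C1]

lemma continuous_on_comp_Pair:
  fixes F :: "'b::real_normed_vector \<times> 'c::real_normed_vector \<Rightarrow> 'd::real_normed_vector"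
  assumes "lipschitz_on_balls F" "continuous_on S x" "continuous_on S z"
  shows "continuous_on S (\<lambda>t. F (x t, z t))"
  by (rule continuous_on_compose2[OF lipschitz_on_balls_continuous_on[OF assms(1), of UNIV]])
    (use assms in \<open>auto intro: continuous_on_Pair\<close>)

lemma continuous_on_grad:
  assumes "continuous_on S x"
  shows "continuous_on S (\<lambda>t. grad f (x t))"
  by (rule continuous_on_compose2[OF lipschitz_on_balls_continuous_on[OF lipschitz_on_balls_grad] assms]) auto

text \<open>This is where \<open>V1_grad\<close> enters: the derivative of \<open>V1\<close> in the direction
of \<open>x1\<close> is a multiple of \<open>\<nabla>f\<close>.\<close>
lemma DV_eq: "DV (x, z) (a, b) = lam * (grad f x \<bullet> a) + grad (\<lambda>y. V1 (x, y)) z \<bullet> b"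
proof -
  note dV = C1_has_derivative[OF V1_C1, of "(x, z)"]
  have "((\<lambda>x. (x, z)) has_derivative (\<lambda>h. (h, 0))) (at x)"
    by (auto intro!: derivative_eq_intros)
  from has_gradient[OF has_derivative_compose[OF this dV]] V1_grad
  have "DV (x, z) (a, 0) = lam * (grad f x \<bullet> a)" by simp
  moreover have "((\<lambda>y. (x, y)) has_derivative (\<lambda>h. (0, h))) (at z)"
    by (auto intro!: derivative_eq_intros)
  from has_gradient[OF has_derivative_compose[OF this dV]]
  have "DV (x, z) (0, b) = grad (\<lambda>y. V1 (x, y)) z \<bullet> b" .
  moreover have "DV (x, z) ((a, 0) + (0, b)) = DV (x, z) (a, 0) + DV (x, z) (0, b)"
    using has_derivative_linear[OF dV] by (rule linear_add)
  ultimately show ?thesis by simp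
qed

lemma alpha_dot_eq: "alpha_dot q \<alpha> x1 x2 z = D\<alpha> (x1, z) (x2, q (x1, z))"
proof -
  note d = C1_has_derivative[OF \<alpha>_C1, of "(x1, z)"]
  have "((\<lambda>x. (x, z)) has_derivative (\<lambda>h. (h, 0))) (at x1)"
    by (auto intro!: derivative_eq_intros)
  from frechet_derivative_at[OF has_derivative_compose[OF this d]]
  have "frechet_derivative (\<lambda>x. \<alpha> (x, z)) (at x1) x2 = D\<alpha> (x1, z) (x2, 0)" by (rule fun_cong[symmetric])
  moreover have "((\<lambda>y. (x1, y)) has_derivative (\<lambda>h. (0, h))) (at z)"
    by (auto intro!: derivative_eq_intros)
  from frechet_derivative_at[OF has_derivative_compose[OF this d]]
  have "frechet_derivative (\<lambda>y. \<alpha> (x1, y)) (at z) (q (x1, z)) = D\<alpha> (x1, z) (0, q (x1, z))" by (rule fun_cong[symmetric])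
  moreover have "D\<alpha> (x1, z) ((x2, 0) + (0, q (x1, z))) = D\<alpha> (x1, z) (x2, 0) + D\<alpha> (x1, z) (0, q (x1, z))"
    using has_derivative_linear[OF d] by (rule linear_add)
  ultimately show ?thesis by (simp add: alpha_dot_def)
qed

lemma hjb_inequality: "0 \<le> DV (x, z) (a, q (x, z)) + Lr (x, z, a)"
  and hjb_equality: "DV (x, z) (\<alpha> (x, z), q (x, z)) = - Lr (x, z, \<alpha> (x, z))"
proof -
  define H where "H = (\<lambda>a. grad (\<lambda>x. V1 (x, z)) x \<bullet> a + grad (\<lambda>y. V1 (x, y)) z \<bullet> q (x, z) + Lr (x, z, a))"
  have H: "H a = DV (x, z) (a, q (x, z)) + Lr (x, z, a)" for a
    using V1_grad by (simp add: H_def DV_eq)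
  have "is_arg_min H (\<lambda>_. True) (\<alpha> (x, z)) \<and> H (\<alpha> (x, z)) = 0"
    using HJB[THEN spec[of _ x], THEN spec[of _ z]] unfolding Let_def H_def .
  then have "H (\<alpha> (x, z)) \<le> H a" "H (\<alpha> (x, z)) = 0" by (auto simp: is_arg_min_linorder)
  then show "0 \<le> DV (x, z) (a, q (x, z)) + Lr (x, z, a)"
    "DV (x, z) (\<alpha> (x, z), q (x, z)) = - Lr (x, z, \<alpha> (x, z))"
    unfolding H by linarith+
qed

text \<open>The Hamiltonian is affine in \<open>a\<close> apart from the running cost, so the HJB equality at
\<open>a = \<alpha>\<close> determines the derivative of \<open>V1\<close> along every velocity
\<open>a\<close>.\<close>
lemma DV_along:
  "DV (x, z) (a, q (x, z)) = lam * (grad f x \<bullet> (a - \<alpha> (x, z))) - Lr (x, z, \<alpha> (x, z))"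
  using hjb_equality[of x z] unfolding DV_eq by (simp add: inner_diff_right algebra_simps)

text \<open>The running cost \<open>Lr\<close> need not be continuous, but along the feedback the HJB equality
expresses it by continuous data. This makes the feedback admissible.\<close>
lemma continuous_on_Lr:
  assumes "continuous_on S x" "continuous_on S z"
  shows "continuous_on S (\<lambda>t. Lr (x t, z t, \<alpha> (x t, z t)))"
proof -
  have "continuous_on S (\<lambda>t. - DV (x t, z t) (\<alpha> (x t, z t), q (x t, z t)))"
    using assms by (intro continuous_on_minus C1_continuous_on_frechet_derivative V1_C1 continuous_on_Pair
        continuous_on_comp_Pair lipschitz_on_balls_q lipschitz_on_balls_\<alpha>)
  then show ?thesis by (simp add: hjb_equality)
qed

lemma continuous_on_alpha_dot:
  assumes "continuous_on S x1" "continuous_on S x2" "continuous_on S z"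
  shows "continuous_on S (\<lambda>t. alpha_dot q \<alpha> (x1 t) (x2 t) (z t))"
  unfolding alpha_dot_eq using assms
  by (intro C1_continuous_on_frechet_derivative \<alpha>_C1 continuous_on_Pair continuous_on_comp_Pair lipschitz_on_balls_q)

lemma continuous_on_err:
  assumes "continuous_on S x1" "continuous_on S x2" "continuous_on S z"
  shows "continuous_on S (\<lambda>t. err \<alpha> (x1 t) (x2 t) (z t))"
  unfolding err_def using assms by (intro continuous_on_diff continuous_on_comp_Pair lipschitz_on_balls_\<alpha>)

lemma continuous_on_u_star:
  assumes "continuous_on S x1" "continuous_on S x2" "continuous_on S z"
  shows "continuous_on S (\<lambda>t. u_star f q \<alpha> lam c (x1 t) (x2 t) (z t))"
  unfolding u_star_def using assms
  by (intro continuous_on_diff continuous_on_scaleR continuous_on_const continuous_on_alpha_dot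
      continuous_on_err continuous_on_grad)

lemma V1_nonneg: "0 \<le> V1 p"
proof -
  have "(INF y. f y) \<le> f (fst p)" by (rule cINF_lower[OF f_bdd]) simp
  then have "0 \<le> c\<^sub>\<phi> * (f (fst p) - (INF y. f y)) + c\<^sub>z * (norm (snd p))\<^sup>2" using consts_pos by simp
  also have "\<dots> \<le> V1 p" using V1_lower by (metis prod.collapse)
  finally show ?thesis .
qed

text \<open>The a priori bound behind global existence. A bound on \<open>V1\<close> bounds \<open>f(x) - inf
f\<close> and \<open>|z|\<close>; smoothness turns the former into a bound on \<open>\<nabla>f\<close>, though
not on \<open>x\<close> itself, and the hypothesis on \<open>\<alpha>\<close> does the rest.\<close>
lemma sublevel_bounds:
  obtains B where "0 < B"
    "\<And>x z. V1 (x, z) \<le> v \<Longrightarrow> norm z \<le> B \<and> norm (grad f x) \<le> B \<and> norm (\<alpha> (x, z)) \<le> B"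
proof -
  let ?K = "\<bar>L\<bar> + 1"
  \<comment> \<open>The 1 ensures that a number whose square is at most R is itself at most R.\<close>
  define R where "R = max 1 (max (v / c\<^sub>z) (4 * ?K * (v / c\<^sub>\<phi>)))"
  have "R \<ge> 1" by (simp add: R_def)
  have sq: "n \<le> R" if "n\<^sup>2 \<le> R" for n
  proof (rule power2_le_imp_le)
    have "R \<le> R\<^sup>2" using \<open>R \<ge> 1\<close> by (intro self_le_power) auto
    with that show "n\<^sup>2 \<le> R\<^sup>2" by simp
  qed (use \<open>R \<ge> 1\<close> in simp)
  have zg: "norm z \<le> R \<and> norm (grad f x) \<le> R" if v: "V1 (x, z) \<le> v" for x z
  proof
    have fx: "(INF y. f y) \<le> f y" for y by (rule cINF_lower[OF f_bdd]) simp
    have le: "c\<^sub>\<phi> * (f x - (INF y. f y)) + c\<^sub>z * (norm z)\<^sup>2 \<le> v" using V1_lower v order_trans by blast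
    have nn: "0 \<le> c\<^sub>\<phi> * (f x - (INF y. f y))" "0 \<le> c\<^sub>z * (norm z)\<^sup>2" using fx consts_pos by auto
    have "c\<^sub>z * (norm z)\<^sup>2 \<le> v" using le nn(1) by linarith
    then have "(norm z)\<^sup>2 \<le> v / c\<^sub>z" using consts_pos by (simp add: field_simps)
    also have "\<dots> \<le> R" by (simp add: R_def)
    finally show "norm z \<le> R" by (rule sq)
    have "c\<^sub>\<phi> * (f x - (INF y. f y)) \<le> v" using le nn(2) by linarith
    then have "f x - (INF y. f y) \<le> v / c\<^sub>\<phi>" using consts_pos by (simp add: field_simps)
    then have "4 * ?K * (f x - (INF y. f y)) \<le> 4 * ?K * (v / c\<^sub>\<phi>)" by (intro mult_left_mono) auto
    moreover have "(norm (grad f x))\<^sup>2 \<le> 4 * ?K * (f x - (INF y. f y))"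
      by (rule norm_gradient_sq_le[OF f_has_derivative grad_lipschitz _ fx]) simp
    moreover have "4 * ?K * (v / c\<^sub>\<phi>) \<le> R" by (simp add: R_def)
    ultimately show "norm (grad f x) \<le> R" by (metis order_trans sq)
  qed
  have "bounded {\<alpha> (x, z) | x z. norm (grad f x) \<le> R \<and> norm z \<le> R}"
    using \<alpha>_bdd \<open>R \<ge> 1\<close> by simp
  then obtain A where "\<forall>y\<in>{\<alpha> (x, z) | x z. norm (grad f x) \<le> R \<and> norm z \<le> R}. norm y \<le> A"
    unfolding bounded_iff by blast
  then have A: "norm (\<alpha> (x, z)) \<le> A" if "norm (grad f x) \<le> R" "norm z \<le> R" for x z
    using that by auto
  show thesis
    by (rule that[of "max R A"]) (use zg A \<open>R \<ge> 1\<close> in \<open>auto simp: le_max_iff_disj\<close>)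
qed

text \<open>Whatever control drives the system, once the \<open>x1\<close> components agree the
\<open>z\<close> components solve the same locally Lipschitz equation. It justifies the definite descriptions
in both cost functionals.\<close>
lemma internal_state_unique:
  assumes z: "ac_solution T z (\<lambda>t. q (x t, z t))" and w: "ac_solution T w (\<lambda>t. q (y t, w t))"
    and x: "continuous_on {0..T} x" and xy: "\<And>t. t \<in> {0..T} \<Longrightarrow> x t = y t"
    and "z 0 = w 0" and t: "t \<in> {0..T}"
  shows "z t = w t"
proof -
  have y: "continuous_on {0..T} y" using x xy continuous_on_cong by metis
  have c: "continuous_on {0..T} z" "continuous_on {0..T} w"
    using z w by (auto dest: ac_solution_continuous_on)
  have "bounded ((\<lambda>t. (x t, z t)) ` {0..T} \<union> (\<lambda>t. (x t, w t)) ` {0..T})"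
    using x c by (intro bounded_Un[THEN iffD2] conjI compact_imp_bounded compact_continuous_image
        continuous_on_Pair) auto
  then obtain R where R: "\<And>p. p \<in> (\<lambda>t. (x t, z t)) ` {0..T} \<union> (\<lambda>t. (x t, w t)) ` {0..T} \<Longrightarrow> norm p \<le> R"
    unfolding bounded_iff by blast
  obtain K where K: "K-lipschitz_on (cball 0 R) q"
    using lipschitz_on_ballsE[OF lipschitz_on_balls_q] by blast
  show ?thesis
  proof (rule gronwall_unique[where x = z and y = w and v = "\<lambda>s. q (x s, z s)" and w = "\<lambda>s. q (y s, w s)" and K = K and T = T,
        OF _ _ _ \<open>z 0 = w 0\<close> t])
    fix s assume s: "s \<in> {0..T}"
    show "(z has_vector_derivative q (x s, z s)) (at s within {0..T})"
      using z s x c by (intro ac_solution_has_vector_derivative continuous_on_comp_Pair lipschitz_on_balls_q)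
    show "(w has_vector_derivative q (y s, w s)) (at s within {0..T})"
      using w s y c by (intro ac_solution_has_vector_derivative continuous_on_comp_Pair lipschitz_on_balls_q)
    show "norm (q (x s, z s) - q (y s, w s)) \<le> K * norm (z s - w s)"
    proof -
      have "(x s, z s) \<in> cball 0 R" "(x s, w s) \<in> cball 0 R"
        using R[of "(x s, z s)"] R[of "(x s, w s)"] s by auto
      from lipschitz_on_normD[OF K this] show ?thesis by (simp add: norm_Pair xy[OF s])
    qed
  qed
qed

section \<open>The reduced problem\<close>

lemma reduced_response_unique:
  assumes r: "reduced_response q T x10 z0 a x z" and r': "reduced_response q T x10 z0 a x' z'"
    and t: "t \<in> {0..T}"
  shows "x t = x' t \<and> z t = z' t"
proof
  have x: "x s = x' s" if "s \<in> {0..T}" for s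
    using r r' that unfolding reduced_response_def by (auto intro: ac_solution_unique)
  then show "x t = x' t" using t .
  show "z t = z' t"
  proof (rule internal_state_unique[OF _ _ _ x _ t])
    show "continuous_on {0..T} x" using r by (auto simp: reduced_response_def dest: ac_solution_continuous_on)
  qed (use r r' in \<open>auto simp: reduced_response_def\<close>)
qed

lemma reduced_cost_eq:
  assumes r: "reduced_response q T x10 z0 a x z" and "0 \<le> T"
  shows "reduced_cost q Lr V1 T x10 z0 a = ereal (V1 (x T, z T)) +
    enn2ereal (\<integral>\<^sup>+ t. ennreal (Lr (x t, z t, a t)) \<partial>lebesgue_on {0..T})"
  unfolding reduced_cost_def
proof (rule the_equality)
  fix J assume "\<exists>x1 z. reduced_response q T x10 z0 a x1 z \<and> J = ereal (V1 (x1 T, z T)) +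
         enn2ereal (\<integral>\<^sup>+ t. ennreal (Lr (x1 t, z t, a t)) \<partial>lebesgue_on {0..T})"
  then obtain x' z' where r': "reduced_response q T x10 z0 a x' z'"
    and J: "J = ereal (V1 (x' T, z' T)) +
         enn2ereal (\<integral>\<^sup>+ t. ennreal (Lr (x' t, z' t, a t)) \<partial>lebesgue_on {0..T})" by blast
  note eq = reduced_response_unique[OF r' r]
  have "(\<integral>\<^sup>+ t. ennreal (Lr (x' t, z' t, a t)) \<partial>lebesgue_on {0..T})
      = (\<integral>\<^sup>+ t. ennreal (Lr (x t, z t, a t)) \<partial>lebesgue_on {0..T})"
    using eq by (intro nn_integral_cong) auto
  then show "J = ereal (V1 (x T, z T)) +
    enn2ereal (\<integral>\<^sup>+ t. ennreal (Lr (x t, z t, a t)) \<partial>lebesgue_on {0..T})"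
    using J eq[of T] \<open>0 \<le> T\<close> by simp
qed (use r in blast)

text \<open>The excess over the optimal cost is the integral of the Hamiltonian, which
\<open>hjb_inequality\<close> makes nonnegative.\<close>
theorem reduced_cost_balance:
  assumes r: "reduced_response q T x10 z0 a x z" and "0 \<le> T"
    and meas: "(\<lambda>t. Lr (x t, z t, a t)) \<in> borel_measurable (lebesgue_on {0..T})"
  shows "reduced_cost q Lr V1 T x10 z0 a = ereal (V1 (x10, z0)) +
    enn2ereal (\<integral>\<^sup>+ t. ennreal (DV (x t, z t) (a t, q (x t, z t)) + Lr (x t, z t, a t)) \<partial>lebesgue_on {0..T})"
proof -
  have "ac_solution T (\<lambda>t. V1 (x t, z t)) (\<lambda>t. DV (x t, z t) (a t, q (x t, z t)))"
    using r unfolding reduced_response_def by (intro ac_solution_compose V1_C1 ac_solution_Pair) auto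
  then have V: "ac_solution T (\<lambda>t. V1 (x t, z t))
      (\<lambda>t. (DV (x t, z t) (a t, q (x t, z t)) + Lr (x t, z t, a t)) - Lr (x t, z t, a t))" by simp
  show ?thesis
    unfolding reduced_cost_eq[OF r \<open>0 \<le> T\<close>]
    using ac_solution_cost_balance(2)[OF V \<open>0 \<le> T\<close> meas] r Lr_nonneg hjb_inequality
    by (simp add: reduced_response_def)
qed

theorem reduced_closed_loop_optimal:
  assumes loop: "reduced_closed_loop q \<alpha> T x10 z0 x z" and "0 \<le> T"
  shows "is_arg_min (reduced_cost q Lr V1 T x10 z0) (reduced_admissible q Lr T x10 z0) (\<lambda>t. \<alpha> (x t, z t))"
  unfolding is_arg_min_linorder
proof (intro conjI allI impI)
  have r: "reduced_response q T x10 z0 (\<lambda>t. \<alpha> (x t, z t)) x z"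
    using loop by (simp add: reduced_closed_loop_def)
  then have c: "continuous_on {0..T} x" "continuous_on {0..T} z"
    unfolding reduced_response_def by (auto dest: ac_solution_continuous_on)
  have meas: "(\<lambda>t. Lr (x t, z t, \<alpha> (x t, z t))) \<in> borel_measurable (lebesgue_on {0..T})"
    using continuous_on_Lr[OF c] by (intro continuous_imp_measurable_on_sets_lebesgue) auto
  have "(\<lambda>t. \<alpha> (x t, z t)) absolutely_integrable_on {0..T}"
    using continuous_on_comp_Pair[OF lipschitz_on_balls_\<alpha> c] by (rule absolutely_integrable_continuous_real)
  with r meas show "reduced_admissible q Lr T x10 z0 (\<lambda>t. \<alpha> (x t, z t))"
    unfolding reduced_admissible_def by blast
  have opt: "reduced_cost q Lr V1 T x10 z0 (\<lambda>t. \<alpha> (x t, z t)) = ereal (V1 (x10, z0))"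
    unfolding reduced_cost_balance[OF r \<open>0 \<le> T\<close> meas] by (simp add: hjb_equality zero_ennreal.rep_eq)
  fix a assume "reduced_admissible q Lr T x10 z0 a"
  then obtain x' z' where "reduced_response q T x10 z0 a x' z'"
    "(\<lambda>t. Lr (x' t, z' t, a t)) \<in> borel_measurable (lebesgue_on {0..T})"
    unfolding reduced_admissible_def by blast
  from reduced_cost_balance[OF this(1) \<open>0 \<le> T\<close> this(2)]
  show "reduced_cost q Lr V1 T x10 z0 (\<lambda>t. \<alpha> (x t, z t)) \<le> reduced_cost q Lr V1 T x10 z0 a"
    unfolding opt by (simp add: ennreal_shift_le_iff)
qed

text \<open>\<open>V1\<close> does not increase along solutions, so \<open>sublevel_bounds\<close> bounds
\<open>z\<close> and the speed \<open>\<alpha>\<close> of \<open>x1\<close>.\<close>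
theorem reduced_closed_loop_exists:
  assumes "0 \<le> T"
  shows "\<exists>x z. reduced_closed_loop q \<alpha> T x10 z0 x z"
proof -
  define F where "F p = (\<alpha> p, q p)" for p
  have F: "lipschitz_on_balls F"
    unfolding F_def by (intro lipschitz_on_balls_Pair lipschitz_on_balls_\<alpha> lipschitz_on_balls_q)
  obtain B where "0 < B" and
    B: "\<And>x z. V1 (x, z) \<le> V1 (x10, z0) \<Longrightarrow> norm z \<le> B \<and> norm (grad f x) \<le> B \<and> norm (\<alpha> (x, z)) \<le> B"
    using sublevel_bounds by blast
  obtain y where y0: "y 0 = (x10, z0)" and
    y: "\<And>t. t \<in> {0..T} \<Longrightarrow> (y has_vector_derivative F (y t)) (at t within {0..T})"
  proof (rule ode_exists_of_a_priori_bound[OF F \<open>0 \<le> T\<close>])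
    fix \<tau> y assume \<tau>: "0 \<le> \<tau>" "\<tau> \<le> T" and y0: "y 0 = (x10, z0)"
      and y: "\<And>t. t \<in> {0..\<tau>} \<Longrightarrow> (y has_vector_derivative F (y t)) (at t within {0..\<tau>})"
    have V: "V1 (y t) \<le> V1 (x10, z0)" if t: "t \<in> {0..\<tau>}" for t
    proof -
      have "V1 (y t) - V1 (y 0) \<le> 0 * (t - 0)"
      proof (rule increment_le_of_derivative_le[where I = "{0..\<tau>}"])
        fix r assume r: "r \<in> {0..t}"
        have "(V1 has_derivative DV (y r)) (at (y r) within y ` {0..\<tau>})"
          using C1_has_derivative[OF V1_C1] by (rule has_derivative_at_withinI)
        from diff_chain_within[OF y[of r, unfolded has_vector_derivative_def] this] r t
        show "((\<lambda>t. V1 (y t)) has_real_derivative DV (y r) (F (y r))) (at r within {0..\<tau>})"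
          by (simp add: has_field_derivative_def o_def mult_commute_abs
              linear_scale[OF has_derivative_linear[OF C1_has_derivative[OF V1_C1]]] mult.commute)
        show "DV (y r) (F (y r)) \<le> 0"
          using hjb_equality[of "fst (y r)" "snd (y r)"] Lr_nonneg by (simp add: F_def)
      qed (use t in auto)
      then show ?thesis using y0 by simp
    qed
    have bnd: "norm (snd (y t)) \<le> B" "norm (\<alpha> (y t)) \<le> B" if "t \<in> {0..\<tau>}" for t
      using B[of "fst (y t)" "snd (y t)"] V[OF that] by auto
    have "norm (fst (y \<tau>) - fst (y 0)) \<le> B * norm (\<tau> - 0)"
    proof (rule norm_increment_le_of_norm_derivative_le[of "{0..\<tau>}"])
      fix t assume t: "t \<in> {0..\<tau>}"
      show "((\<lambda>t. fst (y t)) has_vector_derivative \<alpha> (y t)) (at t within {0..\<tau>})"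
        using has_derivative_fst[OF y[OF t, unfolded has_vector_derivative_def]]
        by (simp add: F_def has_vector_derivative_def)
    qed (use \<tau> bnd(2) in auto)
    also have "\<dots> \<le> B * T" using \<tau> \<open>0 < B\<close> by simp
    finally have "norm (fst (y \<tau>)) \<le> norm x10 + B * T"
      using norm_triangle_sub[of "fst (y \<tau>)" x10] y0 by simp
    then show "norm (y \<tau>) \<le> norm x10 + B * T + B"
      using norm_Pair_le[of "fst (y \<tau>)" "snd (y \<tau>)"] bnd(1)[of \<tau>] \<tau> by simp
  qed blast
  have yc: "continuous_on {0..T} y" by (rule continuous_on_vector_derivative[OF y])
  have "ac_solution T y (\<lambda>t. F (y t))"
    by (intro has_vector_derivative_ac_solution y
        continuous_on_compose2[OF lipschitz_on_balls_continuous_on[OF F] yc]) auto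
  from ac_solution_bounded_linear[OF bounded_linear_fst this]
    ac_solution_bounded_linear[OF bounded_linear_snd this]
  have "reduced_closed_loop q \<alpha> T x10 z0 (\<lambda>t. fst (y t)) (\<lambda>t. snd (y t))"
    using y0 by (simp add: reduced_closed_loop_def reduced_response_def F_def)
  then show ?thesis by blast
qed

section \<open>The outer problem\<close>

text \<open>The left-hand side is the derivative of \<open>V_star\<close> along an arbitrary control value
\<open>u\<close>. The cross term \<open>lam \<nabla>f \<bullet> e\<close> in the derivative of
\<open>V1\<close> cancels against the one that appears when \<open>u - \<alpha>_dot\<close> is expressed
through \<open>w = u - \<alpha>_dot + lam \<nabla>f\<close>; what remains is completed to a square.\<close>
lemma error_derivative_identity:
  "DV (x1, z) (x2, q (x1, z)) + err \<alpha> x1 x2 z \<bullet> (u - alpha_dot q \<alpha> x1 x2 z)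
    = 1 / (2 * c) * (norm (u - u_star f q \<alpha> lam c x1 x2 z))\<^sup>2 - outer_running_cost f q Lr \<alpha> lam c x1 x2 z u"
proof -
  define e where "e = err \<alpha> x1 x2 z"
  define w where "w = u - alpha_dot q \<alpha> x1 x2 z + lam *\<^sub>R grad f x1"
  have "1 / (2 * c) * (norm (u - u_star f q \<alpha> lam c x1 x2 z))\<^sup>2
      = 1 / (2 * c) * (norm w)\<^sup>2 + e \<bullet> w + c / 2 * (norm e)\<^sup>2"
  proof -
    have "u - u_star f q \<alpha> lam c x1 x2 z = w + c *\<^sub>R e" by (simp add: u_star_def w_def e_def)
    then show ?thesis using completing_square[OF c_pos] by simp
  qed
  moreover have "e \<bullet> (u - alpha_dot q \<alpha> x1 x2 z) = e \<bullet> w - lam * (grad f x1 \<bullet> e)"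
    by (simp add: w_def inner_diff_right inner_add_right inner_commute)
  ultimately show ?thesis
    unfolding DV_along outer_running_cost_def w_def[symmetric] e_def[symmetric]
    by (simp add: e_def err_def)
qed

lemma full_response_err:
  assumes r: "full_response q T x10 x20 z0 u x1 x2 z"
  shows "ac_solution T (\<lambda>t. err \<alpha> (x1 t) (x2 t) (z t)) (\<lambda>t. u t - alpha_dot q \<alpha> (x1 t) (x2 t) (z t))"
  unfolding err_def alpha_dot_eq
  using r unfolding full_response_def by (intro ac_solution_diff ac_solution_compose \<alpha>_C1 ac_solution_Pair) auto

lemma full_response_V_star:
  assumes r: "full_response q T x10 x20 z0 u x1 x2 z"
  shows "ac_solution T (\<lambda>t. V_star V1 (x1 t) (z t) (err \<alpha> (x1 t) (x2 t) (z t)))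
    (\<lambda>t. 1 / (2 * c) * (norm (u t - u_star f q \<alpha> lam c (x1 t) (x2 t) (z t)))\<^sup>2
       - outer_running_cost f q Lr \<alpha> lam c (x1 t) (x2 t) (z t) (u t))"
proof -
  have "ac_solution T (\<lambda>t. V1 (x1 t, z t)) (\<lambda>t. DV (x1 t, z t) (x2 t, q (x1 t, z t)))"
    using r unfolding full_response_def by (intro ac_solution_compose V1_C1 ac_solution_Pair) auto
  from ac_solution_add[OF this ac_solution_compose[OF C1_half_norm_sq full_response_err[OF r]]]
  show ?thesis
    unfolding frechet_derivative_half_norm_sq error_derivative_identity V_star_def .
qed

lemma full_response_unique:
  assumes r: "full_response q T x10 x20 z0 u x1 x2 z" and r': "full_response q T x10 x20 z0 u y1 y2 w"
    and t: "t \<in> {0..T}"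
  shows "x1 t = y1 t \<and> x2 t = y2 t \<and> z t = w t"
proof -
  have x2: "x2 s = y2 s" if "s \<in> {0..T}" for s
    using r r' that unfolding full_response_def by (auto intro: ac_solution_unique)
  have x1: "x1 s = y1 s" if s: "s \<in> {0..T}" for s
  proof (rule ac_solution_unique[OF _ _ _ s])
    show "ac_solution T x1 x2" using r by (simp add: full_response_def)
    show "ac_solution T y1 x2"
      using r' x2 unfolding full_response_def by (auto intro: ac_solution_cong[of T y1 y2 x2])
  qed (use r r' in \<open>simp add: full_response_def\<close>)
  have "z t = w t"
  proof (rule internal_state_unique[OF _ _ _ x1 _ t])
    show "continuous_on {0..T} x1" using r by (auto simp: full_response_def dest: ac_solution_continuous_on)
  qed (use r r' in \<open>auto simp: full_response_def\<close>)
  then show ?thesis using x1 x2 t by blast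
qed

lemma outer_cost_eq:
  assumes r: "full_response q T x10 x20 z0 u x1 x2 z" and "0 \<le> T"
  shows "outer_cost f q Lr V1 \<alpha> lam c T x10 x20 z0 u =
    ereal (V_star V1 (x1 T) (z T) (err \<alpha> (x1 T) (x2 T) (z T))) +
    enn2ereal (\<integral>\<^sup>+ t. ennreal (outer_running_cost f q Lr \<alpha> lam c (x1 t) (x2 t) (z t) (u t)) \<partial>lebesgue_on {0..T})"
  unfolding outer_cost_def
proof (rule the_equality)
  fix J assume "\<exists>x1 x2 z. full_response q T x10 x20 z0 u x1 x2 z \<and>
        J = ereal (V_star V1 (x1 T) (z T) (err \<alpha> (x1 T) (x2 T) (z T))) +
            enn2ereal (\<integral>\<^sup>+ t. ennreal (outer_running_cost f q Lr \<alpha> lam c (x1 t) (x2 t) (z t) (u t))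
                         \<partial>lebesgue_on {0..T})"
  then obtain y1 y2 w where r': "full_response q T x10 x20 z0 u y1 y2 w"
    and J: "J = ereal (V_star V1 (y1 T) (w T) (err \<alpha> (y1 T) (y2 T) (w T))) +
            enn2ereal (\<integral>\<^sup>+ t. ennreal (outer_running_cost f q Lr \<alpha> lam c (y1 t) (y2 t) (w t) (u t))
                         \<partial>lebesgue_on {0..T})" by blast
  note eq = full_response_unique[OF r' r]
  have "(\<integral>\<^sup>+ t. ennreal (outer_running_cost f q Lr \<alpha> lam c (y1 t) (y2 t) (w t) (u t)) \<partial>lebesgue_on {0..T})
      = (\<integral>\<^sup>+ t. ennreal (outer_running_cost f q Lr \<alpha> lam c (x1 t) (x2 t) (z t) (u t)) \<partial>lebesgue_on {0..T})"
    using eq by (intro nn_integral_cong) auto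
  then show "J = ereal (V_star V1 (x1 T) (z T) (err \<alpha> (x1 T) (x2 T) (z T))) +
    enn2ereal (\<integral>\<^sup>+ t. ennreal (outer_running_cost f q Lr \<alpha> lam c (x1 t) (x2 t) (z t) (u t)) \<partial>lebesgue_on {0..T})"
    using J eq[of T] \<open>0 \<le> T\<close> by simp
qed (use r in blast)

theorem outer_cost_balance:
  assumes r: "full_response q T x10 x20 z0 u x1 x2 z" and "0 \<le> T"
    and meas: "(\<lambda>t. outer_running_cost f q Lr \<alpha> lam c (x1 t) (x2 t) (z t) (u t))
      \<in> borel_measurable (lebesgue_on {0..T})"
  defines "s \<equiv> \<lambda>t. 1 / (2 * c) * (norm (u t - u_star f q \<alpha> lam c (x1 t) (x2 t) (z t)))\<^sup>2"
  shows "s \<in> borel_measurable (lebesgue_on {0..T})"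
    and "outer_cost f q Lr V1 \<alpha> lam c T x10 x20 z0 u = ereal (V_star V1 x10 z0 (err \<alpha> x10 x20 z0)) +
      enn2ereal (\<integral>\<^sup>+ t. ennreal (s t) \<partial>lebesgue_on {0..T})"
proof -
  have V: "ac_solution T (\<lambda>t. V_star V1 (x1 t) (z t) (err \<alpha> (x1 t) (x2 t) (z t)))
      (\<lambda>t. s t - outer_running_cost f q Lr \<alpha> lam c (x1 t) (x2 t) (z t) (u t))"
    using full_response_V_star[OF r] unfolding s_def .
  have "0 \<le> outer_running_cost f q Lr \<alpha> lam c (x1 t) (x2 t) (z t) (u t)" "0 \<le> s t" for t
    using Lr_nonneg c_pos by (auto simp: outer_running_cost_def s_def)
  from ac_solution_cost_balance[OF V \<open>0 \<le> T\<close> meas this]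
  show "s \<in> borel_measurable (lebesgue_on {0..T})"
    "outer_cost f q Lr V1 \<alpha> lam c T x10 x20 z0 u = ereal (V_star V1 x10 z0 (err \<alpha> x10 x20 z0)) +
      enn2ereal (\<integral>\<^sup>+ t. ennreal (s t) \<partial>lebesgue_on {0..T})"
    unfolding outer_cost_eq[OF r \<open>0 \<le> T\<close>] using r by (simp_all add: full_response_def)
qed

text \<open>The closed loop in the coordinates \<open>(x1, e, z)\<close>, where the derivative of
\<open>\<alpha>\<close> has dropped out and the field is locally Lipschitz.\<close>
abbreviation error_field where
  "error_field \<equiv> \<lambda>(x, e, z). (e + \<alpha> (x, z), - c *\<^sub>R e - lam *\<^sub>R grad f x, q (x, z))"

lemma lipschitz_on_balls_error_field: "lipschitz_on_balls error_field"
proof -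
  have lin: "lipschitz_on_balls (\<lambda>p::(real^'n) \<times> (real^'n) \<times> (real^'m). (fst p, snd (snd p)))"
    "lipschitz_on_balls (\<lambda>p::(real^'n) \<times> (real^'n) \<times> (real^'m). fst (snd p))"
    "lipschitz_on_balls (\<lambda>p::(real^'n) \<times> (real^'n) \<times> (real^'m). - c *\<^sub>R fst (snd p))"
    "lipschitz_on_balls (\<lambda>p::(real^'n) \<times> (real^'n) \<times> (real^'m). fst p)"
    "lipschitz_on_balls (\<lambda>g::real^'n. - lam *\<^sub>R g)"
    by (intro lipschitz_on_balls_bounded_linear bounded_linear_intros)+
  have "lipschitz_on_balls (\<lambda>p. (fst (snd p) + \<alpha> (fst p, snd (snd p)),
      - c *\<^sub>R fst (snd p) + (- lam) *\<^sub>R grad f (fst p), q (fst p, snd (snd p))))"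
    by (intro lipschitz_on_balls_Pair lipschitz_on_balls_add lin
        lipschitz_on_balls_compose[OF lipschitz_on_balls_\<alpha> lin(1)]
        lipschitz_on_balls_compose[OF lipschitz_on_balls_q lin(1)]
        lipschitz_on_balls_compose[OF lin(5) lipschitz_on_balls_compose[OF lipschitz_on_balls_grad lin(4)]])
  then show ?thesis by (simp add: case_prod_beta')
qed

lemma full_closed_loop_derivatives:
  assumes loop: "full_closed_loop f q \<alpha> lam c T x10 x20 z0 x1 x2 z"
  shows "continuous_on {0..T} x1" "continuous_on {0..T} x2" "continuous_on {0..T} z"
    and "\<And>t. t \<in> {0..T} \<Longrightarrow> (x1 has_vector_derivative x2 t) (at t within {0..T})"
    and "\<And>t. t \<in> {0..T} \<Longrightarrow> ((\<lambda>t. (x1 t, err \<alpha> (x1 t) (x2 t) (z t), z t)) has_vector_derivative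
      error_field (x1 t, err \<alpha> (x1 t) (x2 t) (z t), z t)) (at t within {0..T})"
proof -
  have r: "full_response q T x10 x20 z0 (\<lambda>t. u_star f q \<alpha> lam c (x1 t) (x2 t) (z t)) x1 x2 z"
    using loop by (simp add: full_closed_loop_def)
  then have ac: "ac_solution T x1 x2" "ac_solution T z (\<lambda>t. q (x1 t, z t))"
    and "ac_solution T x2 (\<lambda>t. u_star f q \<alpha> lam c (x1 t) (x2 t) (z t))" by (auto simp: full_response_def)
  then show c: "continuous_on {0..T} x1" "continuous_on {0..T} x2" "continuous_on {0..T} z"
    by (auto dest: ac_solution_continuous_on)
  fix t assume t: "t \<in> {0..T}"
  show x1: "(x1 has_vector_derivative x2 t) (at t within {0..T})"
    by (rule ac_solution_has_vector_derivative[OF ac(1) c(2) t])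
  have z: "(z has_vector_derivative q (x1 t, z t)) (at t within {0..T})"
    using c by (intro ac_solution_has_vector_derivative[OF ac(2) _ t] continuous_on_comp_Pair lipschitz_on_balls_q)
  have "((\<lambda>t. err \<alpha> (x1 t) (x2 t) (z t)) has_vector_derivative
      u_star f q \<alpha> lam c (x1 t) (x2 t) (z t) - alpha_dot q \<alpha> (x1 t) (x2 t) (z t)) (at t within {0..T})"
    using c by (intro ac_solution_has_vector_derivative[OF full_response_err[OF r] _ t] continuous_on_diff
        continuous_on_u_star continuous_on_alpha_dot)
  then have e: "((\<lambda>t. err \<alpha> (x1 t) (x2 t) (z t)) has_vector_derivative
      - c *\<^sub>R err \<alpha> (x1 t) (x2 t) (z t) - lam *\<^sub>R grad f (x1 t)) (at t within {0..T})"
    by (simp add: u_star_def)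
  show "((\<lambda>t. (x1 t, err \<alpha> (x1 t) (x2 t) (z t), z t)) has_vector_derivative
      error_field (x1 t, err \<alpha> (x1 t) (x2 t) (z t), z t)) (at t within {0..T})"
    using has_vector_derivative_Pair[OF x1 has_vector_derivative_Pair[OF e z]] by (simp add: err_def)
qed

text \<open>Conversely, solutions in error coordinates are closed-loop trajectories: the derivative of
\<open>\<alpha>\<close> reappears when \<open>x2 = e + \<alpha>(x1, z)\<close> is differentiated.\<close>
lemma error_field_solution_closed_loop:
  assumes y0: "y 0 = (x10, err \<alpha> x10 x20 z0, z0)"
    and y: "\<And>t. t \<in> {0..T} \<Longrightarrow> (y has_vector_derivative error_field (y t)) (at t within {0..T})"
  defines "x1 \<equiv> \<lambda>t. fst (y t)" and "e \<equiv> \<lambda>t. fst (snd (y t))" and "z \<equiv> \<lambda>t. snd (snd (y t))"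
  shows "full_closed_loop f q \<alpha> lam c T x10 x20 z0 x1 (\<lambda>t. e t + \<alpha> (x1 t, z t)) z"
proof -
  let ?x2 = "\<lambda>t. e t + \<alpha> (x1 t, z t)"
  have yc: "continuous_on {0..T} y" by (rule continuous_on_vector_derivative[OF y])
  have ac: "ac_solution T y (\<lambda>t. error_field (y t))"
    by (intro has_vector_derivative_ac_solution y
        continuous_on_compose2[OF lipschitz_on_balls_continuous_on[OF lipschitz_on_balls_error_field] yc]) auto
  have x1: "ac_solution T x1 ?x2"
    using ac_solution_bounded_linear[OF bounded_linear_fst ac]
    by (simp add: x1_def e_def z_def case_prod_beta')
  have e: "ac_solution T e (\<lambda>t. - c *\<^sub>R e t - lam *\<^sub>R grad f (x1 t))"
    using ac_solution_bounded_linear[OF bounded_linear_fst_comp[OF bounded_linear_snd] ac]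
    by (simp add: x1_def e_def z_def case_prod_beta')
  have z: "ac_solution T z (\<lambda>t. q (x1 t, z t))"
    using ac_solution_bounded_linear[OF bounded_linear_snd_comp[OF bounded_linear_snd] ac]
    by (simp add: x1_def e_def z_def case_prod_beta')
  have "ac_solution T ?x2 (\<lambda>t. (- c *\<^sub>R e t - lam *\<^sub>R grad f (x1 t)) + D\<alpha> (x1 t, z t) (?x2 t, q (x1 t, z t)))"
    by (intro ac_solution_add e ac_solution_compose \<alpha>_C1 ac_solution_Pair x1 z)
  then have "ac_solution T ?x2 (\<lambda>t. u_star f q \<alpha> lam c (x1 t) (?x2 t) (z t))"
    by (simp add: u_star_def alpha_dot_eq err_def algebra_simps)
  with x1 z y0 show ?thesis
    by (simp add: full_closed_loop_def full_response_def x1_def e_def z_def err_def)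
qed

lemma full_closed_loop_unique:
  assumes loop: "full_closed_loop f q \<alpha> lam c T x10 x20 z0 x1 x2 z"
    and loop': "full_closed_loop f q \<alpha> lam c T x10 x20 z0 y1 y2 w" and t: "t \<in> {0..T}"
  shows "x1 t = y1 t \<and> x2 t = y2 t \<and> z t = w t"
proof -
  have "(x1 t, err \<alpha> (x1 t) (x2 t) (z t), z t) = (y1 t, err \<alpha> (y1 t) (y2 t) (w t), w t)"
    by (rule ode_unique[OF lipschitz_on_balls_error_field full_closed_loop_derivatives(5)[OF loop]
          full_closed_loop_derivatives(5)[OF loop'] _ t])
      (use loop loop' in \<open>auto simp: full_closed_loop_def full_response_def\<close>)
  then have "x1 t = y1 t" "z t = w t" "x2 t - \<alpha> (x1 t, z t) = y2 t - \<alpha> (y1 t, w t)"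
    by (auto simp: err_def)
  then show ?thesis by simp
qed

lemma closed_loop_running_cost:
  "outer_running_cost f q Lr \<alpha> lam c x1 x2 z (u_star f q \<alpha> lam c x1 x2 z)
    = Lr (x1, z, \<alpha> (x1, z)) + c * (norm (err \<alpha> x1 x2 z))\<^sup>2"
proof -
  have "u_star f q \<alpha> lam c x1 x2 z - alpha_dot q \<alpha> x1 x2 z + lam *\<^sub>R grad f x1
      = - (c *\<^sub>R err \<alpha> x1 x2 z)" by (simp add: u_star_def)
  moreover have "1 / (2 * c) * (c * norm (err \<alpha> x1 x2 z))\<^sup>2 = c / 2 * (norm (err \<alpha> x1 x2 z))\<^sup>2"
    using c_pos by (simp add: power2_eq_square)
  ultimately show ?thesis
    using c_pos by (simp add: outer_running_cost_def)
qed

text \<open>The almost-everywhere identity \<open>full_response_V_star\<close> at \<open>u = u_star\<close>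
has a continuous right-hand side, hence holds everywhere.\<close>
theorem V_star_derivative:
  assumes loop: "full_closed_loop f q \<alpha> lam c T x10 x20 z0 x1 x2 z" and t: "t \<in> {0..T}"
  shows "((\<lambda>s. V_star V1 (x1 s) (z s) (err \<alpha> (x1 s) (x2 s) (z s))) has_real_derivative
      - Lr (x1 t, z t, \<alpha> (x1 t, z t)) - c * (norm (err \<alpha> (x1 t) (x2 t) (z t)))\<^sup>2) (at t within {0..T})"
proof -
  have r: "full_response q T x10 x20 z0 (\<lambda>t. u_star f q \<alpha> lam c (x1 t) (x2 t) (z t)) x1 x2 z"
    using loop by (simp add: full_closed_loop_def)
  note c = full_closed_loop_derivatives(1-3)[OF loop]
  have "ac_solution T (\<lambda>t. V_star V1 (x1 t) (z t) (err \<alpha> (x1 t) (x2 t) (z t)))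
      (\<lambda>t. - Lr (x1 t, z t, \<alpha> (x1 t, z t)) - c * (norm (err \<alpha> (x1 t) (x2 t) (z t)))\<^sup>2)"
    using full_response_V_star[OF r] by (simp add: closed_loop_running_cost)
  moreover have "continuous_on {0..T}
      (\<lambda>t. - Lr (x1 t, z t, \<alpha> (x1 t, z t)) - c * (norm (err \<alpha> (x1 t) (x2 t) (z t)))\<^sup>2)"
    using c by (intro continuous_intros continuous_on_Lr continuous_on_err)
  ultimately show ?thesis
    unfolding has_real_derivative_iff_has_vector_derivative
    using t by (rule ac_solution_has_vector_derivative)
qed

lemma full_closed_loop_decay:
  assumes loop: "full_closed_loop f q \<alpha> lam c T x10 x20 z0 x1 x2 z" and "0 \<le> s" "s \<le> t" "t \<le> T"
    and b: "0 \<le> b" "\<And>r. r \<in> {s..t} \<Longrightarrow> b \<le> norm (grad f (x1 r))"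
  shows "V_star V1 (x1 t) (z t) (err \<alpha> (x1 t) (x2 t) (z t))
    \<le> V_star V1 (x1 s) (z s) (err \<alpha> (x1 s) (x2 s) (z s)) - \<sigma> * b\<^sup>2 * (t - s)"
proof -
  have "V_star V1 (x1 t) (z t) (err \<alpha> (x1 t) (x2 t) (z t)) - V_star V1 (x1 s) (z s) (err \<alpha> (x1 s) (x2 s) (z s))
      \<le> - (\<sigma> * b\<^sup>2) * (t - s)"
  proof (rule increment_le_of_derivative_le[OF V_star_derivative[OF loop]])
    fix r assume r: "r \<in> {s..t}"
    then show "r \<in> {0..T}" using assms by auto
    have "\<sigma> * b\<^sup>2 \<le> \<sigma> * (norm (grad f (x1 r)))\<^sup>2"
      using b(1) b(2)[OF r] consts_pos by (intro mult_left_mono power_mono) auto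
    also have "\<dots> \<le> Lr (x1 r, z r, \<alpha> (x1 r, z r))" using Lr_lower by blast
    finally have "\<sigma> * b\<^sup>2 \<le> Lr (x1 r, z r, \<alpha> (x1 r, z r))" .
    moreover have "0 \<le> c * (norm (err \<alpha> (x1 r) (x2 r) (z r)))\<^sup>2" using c_pos by simp
    ultimately show "- Lr (x1 r, z r, \<alpha> (x1 r, z r)) - c * (norm (err \<alpha> (x1 r) (x2 r) (z r)))\<^sup>2 \<le> - (\<sigma> * b\<^sup>2)"
      by linarith
  qed (use assms in auto)
  then show ?thesis by simp
qed

text \<open>The bound depends on the initial state only, not on the horizon: the existence proof needs it on
all short horizons at once, the convergence proof on all long ones.\<close>
lemma full_closed_loop_bounds:
  obtains B where "0 < B" and "\<And>T x1 x2 z t. full_closed_loop f q \<alpha> lam c T x10 x20 z0 x1 x2 z \<Longrightarrow> t \<in> {0..T} \<Longrightarrow>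
    norm (z t) \<le> B \<and> norm (err \<alpha> (x1 t) (x2 t) (z t)) \<le> B \<and> norm (x2 t) \<le> 2 * B"
proof -
  define v where "v = V_star V1 x10 z0 (err \<alpha> x10 x20 z0)"
  obtain B where "0 < B" and
    B: "\<And>x z. V1 (x, z) \<le> v \<Longrightarrow> norm z \<le> B \<and> norm (grad f x) \<le> B \<and> norm (\<alpha> (x, z)) \<le> B"
    using sublevel_bounds by blast
  show thesis
  proof (rule that[of "max B (sqrt (2 * v))"])
    fix T x1 x2 z t
    assume loop: "full_closed_loop f q \<alpha> lam c T x10 x20 z0 x1 x2 z" and t: "t \<in> {0..T}"
    define e where "e = err \<alpha> (x1 t) (x2 t) (z t)"
    have "V_star V1 (x1 t) (z t) e \<le> v"
      using full_closed_loop_decay[OF loop, of 0 t 0] t loop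
      by (simp add: e_def v_def full_closed_loop_def full_response_def)
    then have V: "V1 (x1 t, z t) + 1/2 * (norm e)\<^sup>2 \<le> v" by (simp add: V_star_def)
    then have "V1 (x1 t, z t) \<le> v" using zero_le_power2[of "norm e"] by linarith
    then have zB: "norm (z t) \<le> B" "norm (\<alpha> (x1 t, z t)) \<le> B" using B by blast+
    have "(norm e)\<^sup>2 \<le> 2 * v" using V V1_nonneg[of "(x1 t, z t)"] by linarith
    then have eB: "norm e \<le> sqrt (2 * v)" by (rule real_le_rsqrt)
    have "x2 t = e + \<alpha> (x1 t, z t)" by (simp add: e_def err_def)
    then have "norm (x2 t) \<le> norm e + norm (\<alpha> (x1 t, z t))" by (simp add: norm_triangle_ineq)
    then show "norm (z t) \<le> max B (sqrt (2 * v)) \<and> norm (err \<alpha> (x1 t) (x2 t) (z t)) \<le> max B (sqrt (2 * v)) \<and>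
        norm (x2 t) \<le> 2 * max B (sqrt (2 * v))"
      using zB eB unfolding e_def[symmetric] by linarith
  qed (use \<open>0 < B\<close> in simp)
qed

theorem full_closed_loop_exists:
  assumes "0 \<le> T"
  shows "\<exists>x1 x2 z. full_closed_loop f q \<alpha> lam c T x10 x20 z0 x1 x2 z"
proof -
  obtain B where "0 < B" and
    B: "\<And>T x1 x2 z t. full_closed_loop f q \<alpha> lam c T x10 x20 z0 x1 x2 z \<Longrightarrow> t \<in> {0..T} \<Longrightarrow>
      norm (z t) \<le> B \<and> norm (err \<alpha> (x1 t) (x2 t) (z t)) \<le> B \<and> norm (x2 t) \<le> 2 * B"
    using full_closed_loop_bounds by blast
  obtain y where "y 0 = (x10, err \<alpha> x10 x20 z0, z0)"
    "\<And>t. t \<in> {0..T} \<Longrightarrow> (y has_vector_derivative error_field (y t)) (at t within {0..T})"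
  proof (rule ode_exists_of_a_priori_bound[OF lipschitz_on_balls_error_field \<open>0 \<le> T\<close>])
    fix \<tau> y assume \<tau>: "0 \<le> \<tau>" "\<tau> \<le> T" and y0: "y 0 = (x10, err \<alpha> x10 x20 z0, z0)"
      and y: "\<And>t. t \<in> {0..\<tau>} \<Longrightarrow> (y has_vector_derivative error_field (y t)) (at t within {0..\<tau>})"
    define x1 e z where "x1 t = fst (y t)" and "e t = fst (snd (y t))" and "z t = snd (snd (y t))" for t
    have loop: "full_closed_loop f q \<alpha> lam c \<tau> x10 x20 z0 x1 (\<lambda>t. e t + \<alpha> (x1 t, z t)) z"
      using error_field_solution_closed_loop[OF y0 y] unfolding x1_def e_def z_def by blast
    have "norm (x1 \<tau> - x1 0) \<le> 2 * B * norm (\<tau> - 0)"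
      by (rule norm_increment_le_of_norm_derivative_le[OF _ full_closed_loop_derivatives(4)[OF loop]])
        (use B[OF loop] \<tau> in auto)
    also have "\<dots> \<le> 2 * B * T" using \<tau> \<open>0 < B\<close> by simp
    finally have "norm (x1 \<tau>) \<le> norm x10 + 2 * B * T"
      using norm_triangle_sub[of "x1 \<tau>" x10] y0 by (simp add: x1_def)
    moreover have "norm (z \<tau>) \<le> B" "norm (e \<tau>) \<le> B"
      using B[OF loop, of \<tau>] \<tau> by (auto simp: err_def)
    moreover have "norm (y \<tau>) \<le> norm (x1 \<tau>) + (norm (e \<tau>) + norm (z \<tau>))"
      using norm_Pair_le[of "fst (y \<tau>)" "snd (y \<tau>)"] norm_Pair_le[of "fst (snd (y \<tau>))" "snd (snd (y \<tau>))"]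
      by (simp add: x1_def e_def z_def)
    ultimately show "norm (y \<tau>) \<le> norm x10 + 2 * B * T + 2 * B" by linarith
  qed blast
  from error_field_solution_closed_loop[OF this] show ?thesis by blast
qed

theorem grad_tendsto_zero:
  assumes loop: "\<And>T. 0 < T \<Longrightarrow> full_closed_loop f q \<alpha> lam c T x10 x20 z0 x1 x2 z"
  shows "((\<lambda>t. grad f (x1 t)) \<longlongrightarrow> 0) at_top"
proof -
  obtain B where "0 < B" and
    B: "\<And>T x1 x2 z t. full_closed_loop f q \<alpha> lam c T x10 x20 z0 x1 x2 z \<Longrightarrow> t \<in> {0..T} \<Longrightarrow>
      norm (z t) \<le> B \<and> norm (err \<alpha> (x1 t) (x2 t) (z t)) \<le> B \<and> norm (x2 t) \<le> 2 * B"
    using full_closed_loop_bounds by blast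
  have loop': "full_closed_loop f q \<alpha> lam c (t + 1) x10 x20 z0 x1 x2 z" if "0 \<le> t" for t
    using that by (intro loop) simp
  have "((\<lambda>t. norm (grad f (x1 t))) \<longlongrightarrow> 0) at_top"
  proof (rule barbalat_dissipation)
    show "0 \<le> V_star V1 (x1 t) (z t) (err \<alpha> (x1 t) (x2 t) (z t))" for t
      using V1_nonneg by (simp add: V_star_def)
    show "V_star V1 (x1 t) (z t) (err \<alpha> (x1 t) (x2 t) (z t))
        \<le> V_star V1 (x1 s) (z s) (err \<alpha> (x1 s) (x2 s) (z s)) - \<sigma> * b\<^sup>2 * (t - s)"
      if "0 \<le> s" "s \<le> t" "0 \<le> b" "\<And>r. r \<in> {s..t} \<Longrightarrow> b \<le> norm (grad f (x1 r))" for s t b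
      using that by (intro full_closed_loop_decay[OF loop'[of t]]) auto
    show "\<bar>norm (grad f (x1 t)) - norm (grad f (x1 s))\<bar> \<le> (\<bar>L\<bar> + 1) * (2 * B) * (t - s)"
      if st: "0 \<le> s" "s \<le> t" for s t
    proof -
      have "\<bar>norm (grad f (x1 t)) - norm (grad f (x1 s))\<bar> \<le> norm (grad f (x1 t) - grad f (x1 s))"
        by (rule norm_triangle_ineq3)
      also have "\<dots> \<le> (\<bar>L\<bar> + 1) * norm (x1 t - x1 s)" by (rule grad_lipschitz)
      also have "\<dots> \<le> (\<bar>L\<bar> + 1) * (2 * B * norm (t - s))"
        by (intro mult_left_mono norm_increment_le_of_norm_derivative_le[OF _ full_closed_loop_derivatives(4)[OF loop'[of t]]])
          (use B[OF loop'[of t]] st in auto)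
      finally show ?thesis using st by (simp add: mult.assoc)
    qed
  qed (use consts_pos \<open>0 < B\<close> in auto)
  then show ?thesis by (rule tendsto_norm_zero_cancel)
qed

theorem full_closed_loop_cost:
  assumes loop: "full_closed_loop f q \<alpha> lam c T x10 x20 z0 x1 x2 z" and "0 \<le> T"
  defines "us \<equiv> \<lambda>t. u_star f q \<alpha> lam c (x1 t) (x2 t) (z t)"
  shows "outer_admissible f q Lr \<alpha> lam c T x10 x20 z0 us"
    and "outer_cost f q Lr V1 \<alpha> lam c T x10 x20 z0 us = ereal (V_star V1 x10 z0 (err \<alpha> x10 x20 z0))"
proof -
  have r: "full_response q T x10 x20 z0 us x1 x2 z"
    using loop by (simp add: full_closed_loop_def us_def)
  note c = full_closed_loop_derivatives(1-3)[OF loop]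
  have "continuous_on {0..T} us"
    unfolding us_def using c by (rule continuous_on_u_star)
  then have "us absolutely_integrable_on {0..T}" by (rule absolutely_integrable_continuous_real)
  moreover have "continuous_on {0..T}
      (\<lambda>t. Lr (x1 t, z t, \<alpha> (x1 t, z t)) + c * (norm (err \<alpha> (x1 t) (x2 t) (z t)))\<^sup>2)"
    using c by (intro continuous_intros continuous_on_Lr continuous_on_err)
  then have meas: "(\<lambda>t. outer_running_cost f q Lr \<alpha> lam c (x1 t) (x2 t) (z t) (us t))
      \<in> borel_measurable (lebesgue_on {0..T})"
    unfolding us_def closed_loop_running_cost by (intro continuous_imp_measurable_on_sets_lebesgue) auto
  ultimately show "outer_admissible f q Lr \<alpha> lam c T x10 x20 z0 us"
    using r unfolding outer_admissible_def by blast
  show "outer_cost f q Lr V1 \<alpha> lam c T x10 x20 z0 us = ereal (V_star V1 x10 z0 (err \<alpha> x10 x20 z0))"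
    using outer_cost_balance(2)[OF r \<open>0 \<le> T\<close> meas] by (simp add: us_def zero_ennreal.rep_eq)
qed

theorem full_closed_loop_optimal:
  assumes loop: "full_closed_loop f q \<alpha> lam c T x10 x20 z0 x1 x2 z" and "0 \<le> T"
  shows "is_arg_min (outer_cost f q Lr V1 \<alpha> lam c T x10 x20 z0) (outer_admissible f q Lr \<alpha> lam c T x10 x20 z0)
    (\<lambda>t. u_star f q \<alpha> lam c (x1 t) (x2 t) (z t))"
  unfolding is_arg_min_linorder
proof (intro conjI allI impI)
  fix u assume "outer_admissible f q Lr \<alpha> lam c T x10 x20 z0 u"
  then obtain y1 y2 w where "full_response q T x10 x20 z0 u y1 y2 w"
    "(\<lambda>t. outer_running_cost f q Lr \<alpha> lam c (y1 t) (y2 t) (w t) (u t)) \<in> borel_measurable (lebesgue_on {0..T})"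
    unfolding outer_admissible_def by blast
  from outer_cost_balance(2)[OF this(1) \<open>0 \<le> T\<close> this(2)]
  show "outer_cost f q Lr V1 \<alpha> lam c T x10 x20 z0 (\<lambda>t. u_star f q \<alpha> lam c (x1 t) (x2 t) (z t))
      \<le> outer_cost f q Lr V1 \<alpha> lam c T x10 x20 z0 u"
    unfolding full_closed_loop_cost(2)[OF loop \<open>0 \<le> T\<close>] by (simp add: ennreal_shift_le_iff)
qed (rule full_closed_loop_cost(1)[OF loop \<open>0 \<le> T\<close>])

text \<open>Minimality forces the excess integral to vanish, so \<open>u\<close> is almost everywhere the
feedback along the response of \<open>u\<close> itself. That response is then a closed-loop trajectory and
coincides with the given one.\<close>
theorem outer_minimizer_unique:
  assumes loop: "full_closed_loop f q \<alpha> lam c T x10 x20 z0 x1 x2 z" and "0 \<le> T"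
    and min: "is_arg_min (outer_cost f q Lr V1 \<alpha> lam c T x10 x20 z0)
      (outer_admissible f q Lr \<alpha> lam c T x10 x20 z0) u"
  shows "AE t in lebesgue_on {0..T}. u t = u_star f q \<alpha> lam c (x1 t) (x2 t) (z t)"
proof -
  from min obtain y1 y2 w where r: "full_response q T x10 x20 z0 u y1 y2 w"
    and meas: "(\<lambda>t. outer_running_cost f q Lr \<alpha> lam c (y1 t) (y2 t) (w t) (u t))
      \<in> borel_measurable (lebesgue_on {0..T})"
    unfolding is_arg_min_linorder outer_admissible_def by blast
  let ?s = "\<lambda>t. 1 / (2 * c) * (norm (u t - u_star f q \<alpha> lam c (y1 t) (y2 t) (w t)))\<^sup>2"
  note balance = outer_cost_balance[OF r \<open>0 \<le> T\<close> meas]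
  have "outer_cost f q Lr V1 \<alpha> lam c T x10 x20 z0 u \<le> ereal (V_star V1 x10 z0 (err \<alpha> x10 x20 z0))"
    using min full_closed_loop_cost[OF loop \<open>0 \<le> T\<close>] unfolding is_arg_min_linorder by metis
  then have "(\<integral>\<^sup>+ t. ennreal (?s t) \<partial>lebesgue_on {0..T}) = 0"
    unfolding balance(2) ennreal_shift_le_iff(2) .
  then have "AE t in lebesgue_on {0..T}. ennreal (?s t) = 0"
    using balance(1) by (subst (asm) nn_integral_0_iff_AE) auto
  then have fb: "AE t in lebesgue_on {0..T}. u t = u_star f q \<alpha> lam c (y1 t) (y2 t) (w t)"
    by eventually_elim (use c_pos in \<open>auto simp: ennreal_eq_0_iff mult_le_0_iff divide_le_0_iff\<close>)
  have "full_closed_loop f q \<alpha> lam c T x10 x20 z0 y1 y2 w"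
    using r ac_solution_cong_AE[OF _ fb] by (simp add: full_closed_loop_def full_response_def)
  note eq = full_closed_loop_unique[OF this loop]
  have "AE t in lebesgue_on {0..T}. t \<in> {0..T}"
    by (intro AE_I2) simp
  with fb show ?thesis
    by eventually_elim (use eq in auto)
qed

end

section \<open>The optimality and convergence theorem\<close>

theorem theorem4:
  fixes f :: "real^'n \<Rightarrow> real"
    and q :: "(real^'n) \<times> (real^'m) \<Rightarrow> real^'m"
    and Lr :: "(real^'n) \<times> (real^'m) \<times> (real^'n) \<Rightarrow> real"
    and V1 :: "(real^'n) \<times> (real^'m) \<Rightarrow> real"
    and \<alpha> :: "(real^'n) \<times> (real^'m) \<Rightarrow> real^'n"
    and L c\<^sub>\<phi> c\<^sub>z lam \<sigma> c :: real
  assumes f_C2: "C2 f"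
    and f_convex: "convex_on UNIV f"
    and f_smooth: "\<forall>x y. norm (grad f x - grad f y) \<le> L * norm (x - y)"
    and f_bdd: "bdd_below (range f)"
    and q_lipschitz: "locally_lipschitz q"
    and Lr_nonneg: "\<forall>x1 z a. 0 \<le> Lr (x1, z, a)"
    and V1_C1: "C1 V1"
    and \<alpha>_C1: "C1 \<alpha>"
    and consts_pos: "c\<^sub>\<phi> > 0" "c\<^sub>z > 0" "lam > 0" "\<sigma> > 0"
    and V1_lower: "\<forall>x1 z. V1 (x1, z) \<ge> c\<^sub>\<phi> * (f x1 - (INF y. f y)) + c\<^sub>z * (norm z)\<^sup>2"
    and V1_grad: "\<forall>x1 z. grad (\<lambda>x. V1 (x, z)) x1 = lam *\<^sub>R grad f x1"
    and HJB: "\<forall>x1 z. let H = (\<lambda>a. grad (\<lambda>x. V1 (x, z)) x1 \<bullet> a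
                              + grad (\<lambda>y. V1 (x1, y)) z \<bullet> q (x1, z) + Lr (x1, z, a))
               in is_arg_min H (\<lambda>_. True) (\<alpha> (x1, z)) \<and> H (\<alpha> (x1, z)) = 0"
    and Lr_lower: "\<forall>x1 z. Lr (x1, z, \<alpha> (x1, z)) \<ge> \<sigma> * (norm (grad f x1))\<^sup>2"
    and \<alpha>_bdd: "\<forall>R>0. bounded {\<alpha> (x1, z) | x1 z. norm (grad f x1) \<le> R \<and> norm z \<le> R}"
    and c_pos: "c > 0"
  shows
    "(\<forall>T>0. \<forall>x10 z0.
        (\<exists>x1 z. reduced_closed_loop q \<alpha> T x10 z0 x1 z) \<and>
        (\<forall>x1 z. reduced_closed_loop q \<alpha> T x10 z0 x1 z \<longrightarrow>
           is_arg_min (reduced_cost q Lr V1 T x10 z0) (reduced_admissible q Lr T x10 z0)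
             (\<lambda>t. \<alpha> (x1 t, z t))))
   \<and>
    (\<forall>T>0. \<forall>x10 x20 z0 x1 x2 z. full_closed_loop f q \<alpha> lam c T x10 x20 z0 x1 x2 z \<longrightarrow>
        (\<forall>t\<in>{0..T}.
           ((\<lambda>s. V_star V1 (x1 s) (z s) (err \<alpha> (x1 s) (x2 s) (z s))) has_real_derivative
              - Lr (x1 t, z t, \<alpha> (x1 t, z t)) - c * (norm (err \<alpha> (x1 t) (x2 t) (z t)))\<^sup>2)
             (at t within {0..T}) \<and>
           - Lr (x1 t, z t, \<alpha> (x1 t, z t)) - c * (norm (err \<alpha> (x1 t) (x2 t) (z t)))\<^sup>2
             \<le> - \<sigma> * (norm (grad f (x1 t)))\<^sup>2 - c * (norm (err \<alpha> (x1 t) (x2 t) (z t)))\<^sup>2))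
   \<and>
    (\<forall>x10 x20 z0 x1 x2 z. (\<forall>T>0. full_closed_loop f q \<alpha> lam c T x10 x20 z0 x1 x2 z) \<longrightarrow>
        ((\<lambda>t. grad f (x1 t)) \<longlongrightarrow> 0) at_top)
   \<and>
    (\<forall>T>0. \<forall>x10 x20 z0.
        (\<exists>x1 x2 z. full_closed_loop f q \<alpha> lam c T x10 x20 z0 x1 x2 z) \<and>
        (\<forall>x1 x2 z. full_closed_loop f q \<alpha> lam c T x10 x20 z0 x1 x2 z \<longrightarrow>
           is_arg_min (outer_cost f q Lr V1 \<alpha> lam c T x10 x20 z0)
             (outer_admissible f q Lr \<alpha> lam c T x10 x20 z0)
             (\<lambda>t. u_star f q \<alpha> lam c (x1 t) (x2 t) (z t)) \<and>
           (\<forall>u. is_arg_min (outer_cost f q Lr V1 \<alpha> lam c T x10 x20 z0)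
                  (outer_admissible f q Lr \<alpha> lam c T x10 x20 z0) u \<longrightarrow>
              (AE t in lebesgue_on {0..T}. u t = u_star f q \<alpha> lam c (x1 t) (x2 t) (z t)))))"
proof -
  interpret nested_hjb f q Lr V1 \<alpha> L c\<^sub>\<phi> c\<^sub>z lam \<sigma> c
    by unfold_locales (fact assms)+
  show ?thesis
  proof (intro conjI allI impI ballI)
    fix T :: real and x10 z0
    assume "T > 0"
    then show "\<exists>x1 z. reduced_closed_loop q \<alpha> T x10 z0 x1 z"
      by (intro reduced_closed_loop_exists) simp
  next
    fix T :: real and x10 z0 x1 z
    assume "T > 0" "reduced_closed_loop q \<alpha> T x10 z0 x1 z"
    then show "is_arg_min (reduced_cost q Lr V1 T x10 z0) (reduced_admissible q Lr T x10 z0)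
        (\<lambda>t. \<alpha> (x1 t, z t))"
      by (intro reduced_closed_loop_optimal) simp_all
  next
    fix T :: real and x10 x20 z0 x1 x2 z t
    assume "full_closed_loop f q \<alpha> lam c T x10 x20 z0 x1 x2 z" "t \<in> {0..T}"
    then show "((\<lambda>s. V_star V1 (x1 s) (z s) (err \<alpha> (x1 s) (x2 s) (z s))) has_real_derivative
        - Lr (x1 t, z t, \<alpha> (x1 t, z t)) - c * (norm (err \<alpha> (x1 t) (x2 t) (z t)))\<^sup>2) (at t within {0..T})"
      by (rule V_star_derivative)
    show "- Lr (x1 t, z t, \<alpha> (x1 t, z t)) - c * (norm (err \<alpha> (x1 t) (x2 t) (z t)))\<^sup>2
        \<le> - \<sigma> * (norm (grad f (x1 t)))\<^sup>2 - c * (norm (err \<alpha> (x1 t) (x2 t) (z t)))\<^sup>2"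
      using Lr_lower by simp
  next
    fix x10 x20 z0 x1 x2 z
    assume "\<forall>T>0. full_closed_loop f q \<alpha> lam c T x10 x20 z0 x1 x2 z"
    then show "((\<lambda>t. grad f (x1 t)) \<longlongrightarrow> 0) at_top"
      by (intro grad_tendsto_zero) blast
  next
    fix T :: real and x10 x20 z0
    assume "T > 0"
    then show "\<exists>x1 x2 z. full_closed_loop f q \<alpha> lam c T x10 x20 z0 x1 x2 z"
      by (intro full_closed_loop_exists) simp
  next
    fix T :: real and x10 x20 z0 x1 x2 z
    assume "T > 0" "full_closed_loop f q \<alpha> lam c T x10 x20 z0 x1 x2 z"
    then show "is_arg_min (outer_cost f q Lr V1 \<alpha> lam c T x10 x20 z0)
        (outer_admissible f q Lr \<alpha> lam c T x10 x20 z0) (\<lambda>t. u_star f q \<alpha> lam c (x1 t) (x2 t) (z t))"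
      by (intro full_closed_loop_optimal) simp_all
  next
    fix T :: real and x10 x20 z0 x1 x2 z u
    assume "T > 0" "full_closed_loop f q \<alpha> lam c T x10 x20 z0 x1 x2 z"
      and "is_arg_min (outer_cost f q Lr V1 \<alpha> lam c T x10 x20 z0)
        (outer_admissible f q Lr \<alpha> lam c T x10 x20 z0) u"
    then show "AE t in lebesgue_on {0..T}. u t = u_star f q \<alpha> lam c (x1 t) (x2 t) (z t)"
      by (intro outer_minimizer_unique[of T x10 x20 z0 x1 x2 z]) simp_all
  qed
qed

end
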